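(* There is an algorithm that, given a finite simple undirected graph $G=(V,E)$ with $n=|V|$, outputs a set of $O(\log n)$ clusterings of $V$ such that for every $\lambda\in(0,1)$ the set contains a clustering $\mathcal{C}$ with $\mathrm{LamPrime}(\mathcal{C},\lambda)\le O(\log n)\cdot \min_{\mathcal{C}'}\mathrm{LamPrime}(\mathcal{C}',\lambda)$ (minimum over all clusterings $\mathcal{C}'$ of $V$). The algorithm runs in $O(T_{LP}\log n)$ time, where $T_{LP}$ is the time needed to solve the LambdaPrime LP relaxation for a single value of $\lambda$.
   Context: A clustering of $V$ is a partition of $V$. For $S\subseteq V$, $\mathrm{cut}(S)$ is the number of edges with exactly one endpoint in $S$. The LambdaPrime objective is $\mathrm{LamPrime}(\mathcal{C},\lambda)=\sum_{S\in\mathcal{C}}\left(\tfrac12\mathrm{cut}(S)+\lambda\binom{|S|}{2}\right)$. The LambdaPrime LP relaxation with parameter $\lambda$ has variables $x_{ij}$ for unordered pairs $i<j$ and is: minimize $\sum_{(i,j)\in E}x_{ij}+\sum_{i<j}\lambda(1-x_{ij})$ subject to $x_{ij}\le x_{ik}+x_{jk}$ for all $i,j,k$ and $0\le x_{ij}\le 1$. *)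

theory Defs
  imports Complex_Main "HOL-Library.Disjoint_Sets" "HOL-Library.Landau_Symbols"
begin

section \<open>Graphs, clusterings, and the LambdaPrime objective\<close>

definition pairs :: "'a set \<Rightarrow> 'a set set" where
  "pairs V = {e. e \<subseteq> V \<and> card e = 2}"

definition simple_graph :: "'a set \<Rightarrow> 'a set set \<Rightarrow> bool" where
  "simple_graph V E \<longleftrightarrow> finite V \<and> E \<subseteq> pairs V"

definition cut :: "'a set set \<Rightarrow> 'a set \<Rightarrow> nat" where
  "cut E S = card {e \<in> E. card (e \<inter> S) = 1}"

definition LamPrime :: "'a set set \<Rightarrow> 'a set set \<Rightarrow> real \<Rightarrow> real" where
  "LamPrime E C l = (\<Sum>S\<in>C. 1/2 * real (cut E S) + l * real (card S choose 2))"

definition LamPrime_min :: "'a set \<Rightarrow> 'a set set \<Rightarrow> real \<Rightarrow> real" where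
  "LamPrime_min V E l = Min {LamPrime E C l | C. partition_on V C}"


section \<open>The LP relaxation\<close>

text \<open>The LP variables are indexed by unordered pairs, so there is no variable for \<open>i = j\<close>
  and the triangle inequalities range over distinct vertices.\<close>

definition lp_feasible :: "'a set \<Rightarrow> ('a set \<Rightarrow> real) \<Rightarrow> bool" where
  "lp_feasible V x \<longleftrightarrow>
     (\<forall>i\<in>V. \<forall>j\<in>V. \<forall>k\<in>V. i \<noteq> j \<and> j \<noteq> k \<and> i \<noteq> k \<longrightarrow> x {i, j} \<le> x {i, k} + x {j, k}) \<and>
     (\<forall>e\<in>pairs V. 0 \<le> x e \<and> x e \<le> 1)"

definition lp_objective :: "'a set \<Rightarrow> 'a set set \<Rightarrow> real \<Rightarrow> ('a set \<Rightarrow> real) \<Rightarrow> real" where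
  "lp_objective V E l x = (\<Sum>e\<in>E. x e) + (\<Sum>e\<in>pairs V. l * (1 - x e))"

definition lp_optimal :: "'a set \<Rightarrow> 'a set set \<Rightarrow> real \<Rightarrow> ('a set \<Rightarrow> real) \<Rightarrow> bool" where
  "lp_optimal V E l x \<longleftrightarrow>
     lp_feasible V x \<and> (\<forall>y. lp_feasible V y \<longrightarrow> lp_objective V E l x \<le> lp_objective V E l y)"


section \<open>Algorithms: a uniform-cost real RAM\<close>

text \<open>Memory consists of named two-dimensional arrays of natural numbers and of exact real
  numbers; scalars live in cell (0, 0). Natural numbers have addition and truncated subtraction,
  reals the four field operations and comparison. There is no conversion from reals to naturals
  (no floor), and program texts contain no real constants, only natural ones.\<close>

type_synonym vname = string

record state =
  nmem :: "vname \<Rightarrow> nat \<Rightarrow> nat \<Rightarrow> nat"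
  rmem :: "vname \<Rightarrow> nat \<Rightarrow> nat \<Rightarrow> real"

datatype nexp = NConst nat | NGet vname nexp nexp | NAdd nexp nexp | NSub nexp nexp

datatype rexp = ROfNat nexp | RGet vname nexp nexp
  | RAdd rexp rexp | RSub rexp rexp | RMul rexp rexp | RDiv rexp rexp

datatype bexp = NLess nexp nexp | RLess rexp rexp | BNot bexp | BAnd bexp bexp

text \<open>\<open>Solve a\<close> calls an LP solver, whose code is a parameter of the semantics, for
  \<open>\<lambda> = a\<close>.\<close>

datatype com = Skip
  | NSet vname nexp nexp nexp
  | RSet vname nexp nexp rexp
  | Seq com com
  | Cond bexp com com
  | While bexp com
  | Solve rexp

primrec nval :: "nexp \<Rightarrow> state \<Rightarrow> nat" where
  "nval (NConst k) s = k"
| "nval (NGet a i j) s = nmem s a (nval i s) (nval j s)"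
| "nval (NAdd p q) s = nval p s + nval q s"
| "nval (NSub p q) s = nval p s - nval q s"

primrec rval :: "rexp \<Rightarrow> state \<Rightarrow> real" where
  "rval (ROfNat p) s = real (nval p s)"
| "rval (RGet a i j) s = rmem s a (nval i s) (nval j s)"
| "rval (RAdd p q) s = rval p s + rval q s"
| "rval (RSub p q) s = rval p s - rval q s"
| "rval (RMul p q) s = rval p s * rval q s"
| "rval (RDiv p q) s = rval p s / rval q s"

primrec bval :: "bexp \<Rightarrow> state \<Rightarrow> bool" where
  "bval (NLess p q) s \<longleftrightarrow> nval p s < nval q s"
| "bval (RLess p q) s \<longleftrightarrow> rval p s < rval q s"
| "bval (BNot b) s \<longleftrightarrow> \<not> bval b s"
| "bval (BAnd b c) s \<longleftrightarrow> bval b s \<and> bval c s"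

text \<open>Evaluating an expression costs one time unit per node of its syntax tree.\<close>

primrec ncost :: "nexp \<Rightarrow> nat" where
  "ncost (NConst k) = 1"
| "ncost (NGet a i j) = 1 + ncost i + ncost j"
| "ncost (NAdd p q) = 1 + ncost p + ncost q"
| "ncost (NSub p q) = 1 + ncost p + ncost q"

primrec rcost :: "rexp \<Rightarrow> nat" where
  "rcost (ROfNat p) = 1 + ncost p"
| "rcost (RGet a i j) = 1 + ncost i + ncost j"
| "rcost (RAdd p q) = 1 + rcost p + rcost q"
| "rcost (RSub p q) = 1 + rcost p + rcost q"
| "rcost (RMul p q) = 1 + rcost p + rcost q"
| "rcost (RDiv p q) = 1 + rcost p + rcost q"

primrec bcost :: "bexp \<Rightarrow> nat" where
  "bcost (NLess p q) = 1 + ncost p + ncost q"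
| "bcost (RLess p q) = 1 + rcost p + rcost q"
| "bcost (BNot b) = 1 + bcost b"
| "bcost (BAnd b c) = 1 + bcost b + bcost c"

definition upd :: "(vname \<Rightarrow> nat \<Rightarrow> nat \<Rightarrow> 'v) \<Rightarrow> vname \<Rightarrow> nat \<Rightarrow> nat \<Rightarrow> 'v \<Rightarrow> (vname \<Rightarrow> nat \<Rightarrow> nat \<Rightarrow> 'v)" where
  "upd m a i j v = m(a := (m a)(i := (m a i)(j := v)))"

text \<open>\<open>exec P c s t s'\<close>: with LP solver \<open>P\<close>, the program \<open>c\<close> started in memory \<open>s\<close> halts
  after \<open>t\<close> time units in memory \<open>s'\<close>. The solver works on its own memory, except that it writes
  its result to the caller's array \<open>x\<close>. The private memory starts as a copy of the caller's,
  with the LP parameter in \<open>lam\<close>; this gives it access to the graph, while the remaining contents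
  are irrelevant because solvers have to cope with arbitrary initial contents (see \<open>lp_solver\<close>
  below).\<close>

inductive exec :: "com \<Rightarrow> com \<Rightarrow> state \<Rightarrow> nat \<Rightarrow> state \<Rightarrow> bool" for P where
  Skip: "exec P Skip s 1 s"
| NSet: "exec P (NSet a i j p) s (1 + ncost i + ncost j + ncost p)
           (s\<lparr>nmem := upd (nmem s) a (nval i s) (nval j s) (nval p s)\<rparr>)"
| RSet: "exec P (RSet a i j p) s (1 + ncost i + ncost j + rcost p)
           (s\<lparr>rmem := upd (rmem s) a (nval i s) (nval j s) (rval p s)\<rparr>)"
| Seq: "exec P c s t s' \<Longrightarrow> exec P d s' u s'' \<Longrightarrow> exec P (Seq c d) s (1 + t + u) s''"
| CondTrue: "bval b s \<Longrightarrow> exec P c s t s' \<Longrightarrow> exec P (Cond b c d) s (1 + bcost b + t) s'"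
| CondFalse: "\<not> bval b s \<Longrightarrow> exec P d s t s' \<Longrightarrow> exec P (Cond b c d) s (1 + bcost b + t) s'"
| WhileFalse: "\<not> bval b s \<Longrightarrow> exec P (While b c) s (1 + bcost b) s"
| WhileTrue: "bval b s \<Longrightarrow> exec P c s t s' \<Longrightarrow> exec P (While b c) s' u s'' \<Longrightarrow>
    exec P (While b c) s (1 + bcost b + t + u) s''"
| Solve: "exec P P (s\<lparr>rmem := upd (rmem s) ''lam'' 0 0 (rval a s)\<rparr>) t s' \<Longrightarrow>
    exec P (Solve a) s (1 + rcost a + t) (s\<lparr>rmem := (rmem s)(''x'' := rmem s' ''x'')\<rparr>)"

inductive_cases exec_elims:
  "exec P Skip s t s'" "exec P (NSet a i j p) s t s'" "exec P (RSet a i j q) s t s'"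
  "exec P (Seq c d) s t s'" "exec P (Cond b c d) s t s'" "exec P (While b c) s t s'"
  "exec P (Solve q) s t s'"

lemma exec_deterministic:
  assumes "exec P c s t s'" and "exec P c s v r"
  shows "t = v \<and> s' = r"
  using assms
proof (induction arbitrary: v r rule: exec.induct)
  case (Seq c s t s' d u s'' v r)
  from Seq.prems obtain t1 s1 u1 where "v = 1 + t1 + u1" "exec P c s t1 s1" "exec P d s1 u1 r"
    by (rule exec_elims) simp
  with Seq.IH show ?case by metis
next
  case (CondTrue b s c t s' d v r)
  from CondTrue.prems show ?case
    by (rule exec_elims) (use CondTrue.hyps(1) CondTrue.IH in auto)
next
  case (CondFalse b s d t s' c v r)
  from CondFalse.prems show ?case
    by (rule exec_elims) (use CondFalse.hyps(1) CondFalse.IH in auto)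
next
  case (WhileFalse b s c v r)
  from WhileFalse.prems show ?case
    by (rule exec_elims) (use WhileFalse.hyps(1) in auto)
next
  case (WhileTrue b s c t s' u s'' v r)
  from WhileTrue.prems obtain t1 s1 u1
    where "v = 1 + bcost b + t1 + u1" "exec P c s t1 s1" "exec P (While b c) s1 u1 r"
    by (rule exec_elims) (use WhileTrue.hyps(1) in simp_all)
  with WhileTrue.IH show ?case by metis
next
  case (Solve s a t s' v r)
  from Solve.prems obtain t1 s1 where
    "v = 1 + rcost a + t1" "r = s\<lparr>rmem := (rmem s)(''x'' := rmem s1 ''x'')\<rparr>"
    "exec P P (s\<lparr>rmem := upd (rmem s) ''lam'' 0 0 (rval a s)\<rparr>) t1 s1"
    by (rule exec_elims) simp
  with Solve.IH show ?case by metis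
qed (erule exec_elims, simp)+

primrec solve_free :: "com \<Rightarrow> bool" where
  "solve_free Skip \<longleftrightarrow> True"
| "solve_free (NSet a i j p) \<longleftrightarrow> True"
| "solve_free (RSet a i j p) \<longleftrightarrow> True"
| "solve_free (Seq c d) \<longleftrightarrow> solve_free c \<and> solve_free d"
| "solve_free (Cond b c d) \<longleftrightarrow> solve_free c \<and> solve_free d"
| "solve_free (While b c) \<longleftrightarrow> solve_free c"
| "solve_free (Solve a) \<longleftrightarrow> False"


section \<open>Input and output conventions\<close>

text \<open>A graph on \<open>{..<n}\<close> is given by its adjacency matrix; all other cells are unconstrained.\<close>

definition holds_graph :: "state \<Rightarrow> nat \<Rightarrow> nat set set \<Rightarrow> bool" where
  "holds_graph s n E \<longleftrightarrow> nmem s ''n'' 0 0 = n \<and>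
     (\<forall>i<n. \<forall>j<n. nmem s ''adj'' i j = (if {i, j} \<in> E then 1 else 0))"

definition lp_output :: "state \<Rightarrow> nat set \<Rightarrow> real" where
  "lp_output s e = rmem s ''x'' (Min e) (Max e)"

text \<open>\<open>T n E\<close> bounds the time that \<open>P\<close> needs for the graph \<open>({..<n}, E)\<close>, for any single value
  of \<open>\<lambda>\<close>.\<close>

definition lp_solver :: "com \<Rightarrow> (nat \<Rightarrow> nat set set \<Rightarrow> nat) \<Rightarrow> bool" where
  "lp_solver P T \<longleftrightarrow> solve_free P \<and>
     (\<forall>n E s. simple_graph {..<n} E \<and> holds_graph s n E \<and> 0 < rmem s ''lam'' 0 0 \<and> rmem s ''lam'' 0 0 < 1 \<longrightarrow>
        (\<exists>t s'. exec P P s t s' \<and> t \<le> T n E \<and>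
                lp_optimal {..<n} E (rmem s ''lam'' 0 0) (lp_output s')))"

text \<open>Clustering number \<open>k\<close> is given by a label \<open>c k i\<close> for every vertex \<open>i\<close>; its clusters are the
  nonempty label classes.\<close>

definition clustering_of_labels :: "nat \<Rightarrow> (nat \<Rightarrow> nat) \<Rightarrow> nat set set" where
  "clustering_of_labels n f = (\<lambda>i. {j. j < n \<and> f j = f i}) ` {..<n}"

definition output_clusterings :: "state \<Rightarrow> nat \<Rightarrow> nat set set set" where
  "output_clusterings s n = (\<lambda>k. clustering_of_labels n (nmem s ''c'' k)) ` {..<nmem s ''count'' 0 0}"

end

theory Submission
  imports Defs
begin

text \<open>The LP is solved for \<open>\<lambda> = 1/2, 1/4, \<dots>, 1/2^k\<close> with \<open>k = O(log n)\<close>. Neighbouring parameters change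
  costs by at most a factor of 2, and below \<open>1/2^k\<close> a good clustering for \<open>1/2^k\<close> cuts no edge and
  stays good.

  Each LP solution, viewed as a metric, is rounded by growing balls. A ball is extended by its
  closest remaining vertex until its cut is at most \<open>8k\<close> times its volume, the LP weight of the edges
  that it touches plus \<open>\<lambda>/n\<close>; it then becomes a cluster. As long as this fails, the volume grows
  exponentially with rate \<open>8k\<close> in the radius, so balls are closed before the radius exceeds \<open>1/4\<close>:
  pairs within a cluster are at distance at most \<open>1/2\<close>, and the cuts are charged to disjoint
  volumes. The seed \<open>\<lambda>/n\<close> is affordable because every edge contributes at least \<open>\<lambda>\<close> to the LP
  value.

  Adding one vertex takes time \<open>O(n)\<close>, so a rounding takes \<open>O(n\<^sup>2)\<close>. This is dominated by the time
  of the LP solver, which has to write the values of all pairs.\<close>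

section \<open>Running programs\<close>

text \<open>The usual ball volume counts a cut edge only up to the current radius. The closing test
  uses \<open>volume\<close> instead, which counts such an edge in full. It depends on the vertex
  set alone, costs a few additions per neighbour to maintain, and still dominates
  \<open>ballvol\<close> at the radius where the next vertex joins. Hence only those radii are
  inspected, and \<open>ballvol\<close> occurs in the analysis alone.

  The rate \<open>8 * k\<close> is chosen so that radius \<open>1 / 4\<close> yields the factor
  \<open>exp (2 * k)\<close>, which is at least \<open>4 ^ k\<close>. A ball can outgrow its seed
  \<lambda>/n at most by a factor of \<open>1 + n ^ 3 / \<lambda>\<close>; one \<open>2 ^ k\<close>
  pays for \<open>1 / \<lambda>\<close>, the other for \<open>1 + n ^ 3\<close>. The same k thus
  controls the number of LPs, the growth rate and the approximation ratio.\<close>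

primrec nwrites :: "com \<Rightarrow> vname set" where
  "nwrites Skip = {}"
| "nwrites (NSet a i j p) = {a}"
| "nwrites (RSet a i j p) = {}"
| "nwrites (Seq c d) = nwrites c \<union> nwrites d"
| "nwrites (Cond b c d) = nwrites c \<union> nwrites d"
| "nwrites (While b c) = nwrites c"
| "nwrites (Solve a) = {}"

primrec rwrites :: "com \<Rightarrow> vname set" where
  "rwrites Skip = {}"
| "rwrites (NSet a i j p) = {}"
| "rwrites (RSet a i j p) = {a}"
| "rwrites (Seq c d) = rwrites c \<union> rwrites d"
| "rwrites (Cond b c d) = rwrites c \<union> rwrites d"
| "rwrites (While b c) = rwrites c"
| "rwrites (Solve a) = {''x''}"

definition frame :: "vname set \<Rightarrow> vname set \<Rightarrow> state \<Rightarrow> state \<Rightarrow> bool" where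
  "frame X Y s s' \<longleftrightarrow> (\<forall>a. a \<notin> X \<longrightarrow> nmem s' a = nmem s a) \<and> (\<forall>a. a \<notin> Y \<longrightarrow> rmem s' a = rmem s a)"

lemma frame_trans: "frame X Y s s' \<Longrightarrow> frame X Y s' s'' \<Longrightarrow> frame X Y s s''"
  by (simp add: frame_def)

lemma frame_mono: "frame X Y s s' \<Longrightarrow> X \<subseteq> X' \<Longrightarrow> Y \<subseteq> Y' \<Longrightarrow> frame X' Y' s s'"
  unfolding frame_def by blast

lemma frame_nmem: "frame X Y s s' \<Longrightarrow> a \<notin> X \<Longrightarrow> nmem s' a = nmem s a"
  by (simp add: frame_def)

lemma upd_apply: "upd m a i j v b p q = (if b = a \<and> p = i \<and> q = j then v else m b p q)"
  by (simp add: upd_def)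

lemma upd_other: "b \<noteq> a \<Longrightarrow> upd m a i j v b = m b"
  by (simp add: upd_def)

lemma exec_frame: "exec P c s t s' \<Longrightarrow> frame (nwrites c) (rwrites c) s s'"
proof (induction rule: exec.induct)
  case (Seq c s t s' d u s'')
  then show ?case by (auto simp: frame_def)
qed (auto simp: frame_def upd_other)

section \<open>Total correctness with time bounds\<close>

definition runs :: "com \<Rightarrow> com \<Rightarrow> state \<Rightarrow> nat \<Rightarrow> (state \<Rightarrow> bool) \<Rightarrow> bool" where
  "runs P c s B Q \<longleftrightarrow> (\<exists>t s'. exec P c s t s' \<and> t \<le> B \<and> Q s')"

text \<open>The consequence rule hands the frame to the new postcondition, as does
  \<open>runs_Seq\<close> to the second program. Postconditions and invariants therefore only speak
  of what the code changes.\<close>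

lemma runs_mono:
  assumes "runs P c s B Q" and "B \<le> B'"
    and "\<And>s'. Q s' \<Longrightarrow> frame (nwrites c) (rwrites c) s s' \<Longrightarrow> Q' s'"
  shows "runs P c s B' Q'"
  using assms exec_frame unfolding runs_def by (meson order_trans)

lemma runs_Seq:
  assumes "runs P c s B Q"
    and "\<And>s'. Q s' \<Longrightarrow> frame (nwrites c) (rwrites c) s s' \<Longrightarrow> runs P d s' B' Q'"
    and "1 + B + B' \<le> B''"
  shows "runs P (Seq c d) s B'' Q'"
proof -
  obtain t s1 where 1: "exec P c s t s1" "t \<le> B" "Q s1"
    using assms(1) by (auto simp: runs_def)
  obtain t' s2 where 2: "exec P d s1 t' s2" "t' \<le> B'" "Q' s2"
    using assms(2)[OF 1(3) exec_frame[OF 1(1)]] by (auto simp: runs_def)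
  show ?thesis
    using exec.Seq[OF 1(1) 2(1)] 1(2) 2(2,3) assms(3) unfolding runs_def
    by (intro exI[of _ "1 + t + t'"] exI[of _ s2]) simp
qed

primrec loop_free :: "com \<Rightarrow> bool" where
  "loop_free Skip \<longleftrightarrow> True"
| "loop_free (NSet a i j p) \<longleftrightarrow> True"
| "loop_free (RSet a i j p) \<longleftrightarrow> True"
| "loop_free (Seq c d) \<longleftrightarrow> loop_free c \<and> loop_free d"
| "loop_free (Cond b c d) \<longleftrightarrow> loop_free c \<and> loop_free d"
| "loop_free (While b c) \<longleftrightarrow> False"
| "loop_free (Solve a) \<longleftrightarrow> False"

text \<open>The values at \<open>While\<close> and \<open>Solve\<close> are junk.\<close>

primrec den :: "com \<Rightarrow> state \<Rightarrow> state" where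
  "den Skip s = s"
| "den (NSet a i j p) s = s\<lparr>nmem := upd (nmem s) a (nval i s) (nval j s) (nval p s)\<rparr>"
| "den (RSet a i j p) s = s\<lparr>rmem := upd (rmem s) a (nval i s) (nval j s) (rval p s)\<rparr>"
| "den (Seq c d) s = den d (den c s)"
| "den (Cond b c d) s = (if bval b s then den c s else den d s)"
| "den (While b c) s = s"
| "den (Solve a) s = s"

text \<open>A bound that does not depend on the state: a conditional is charged for both branches,
  so the value is a plain sum of numerals.\<close>

primrec cst :: "com \<Rightarrow> nat" where
  "cst Skip = 1"
| "cst (NSet a i j p) = 1 + ncost i + ncost j + ncost p"
| "cst (RSet a i j p) = 1 + ncost i + ncost j + rcost p"
| "cst (Seq c d) = 1 + cst c + cst d"
| "cst (Cond b c d) = 1 + bcost b + (cst c + cst d)"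
| "cst (While b c) = 0"
| "cst (Solve a) = 0"

lemma runs_den: "loop_free c \<Longrightarrow> runs P c s (cst c) (\<lambda>s'. s' = den c s)"
proof (induction c arbitrary: s)
  case (Seq c d)
  show ?case
    by (rule runs_Seq[OF Seq.IH(1) Seq.IH(2)[THEN runs_mono]]) (use Seq.prems in auto)
next
  case (Cond b c d)
  obtain t where t: "exec P c s t (den c s)" "t \<le> cst c"
    using Cond by (auto simp: runs_def)
  obtain t' where t': "exec P d s t' (den d s)" "t' \<le> cst d"
    using Cond by (auto simp: runs_def)
  show ?case
  proof (cases "bval b s")
    case True
    then show ?thesis
      using exec.CondTrue[OF True t(1), of d] t(2) by (fastforce simp: runs_def)
  next
    case False
    then show ?thesis
      using exec.CondFalse[OF False t'(1), of c] t'(2) by (fastforce simp: runs_def)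
  qed
qed (auto simp: runs_def intro: exec.intros)

lemma runs_loop_free:
  assumes "loop_free c" and "cst c \<le> B" and "Q (den c s)"
  shows "runs P c s B Q"
  using runs_mono[OF runs_den[OF assms(1)] assms(2)] assms(3) by blast

abbreviation nvar :: "vname \<Rightarrow> nexp" where
  "nvar a \<equiv> NGet a (NConst 0) (NConst 0)"

abbreviation rvar :: "vname \<Rightarrow> rexp" where
  "rvar a \<equiv> RGet a (NConst 0) (NConst 0)"

abbreviation nset :: "vname \<Rightarrow> nexp \<Rightarrow> com" where
  "nset a \<equiv> NSet a (NConst 0) (NConst 0)"

abbreviation rset :: "vname \<Rightarrow> rexp \<Rightarrow> com" where
  "rset a \<equiv> RSet a (NConst 0) (NConst 0)"

definition For :: "vname \<Rightarrow> vname \<Rightarrow> com \<Rightarrow> com" where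
  "For i b c = Seq (nset i (NConst 0))
     (While (NLess (nvar i) (nvar b)) (Seq c (nset i (NAdd (nvar i) (NConst 1)))))"

lemma nwrites_For [simp]: "nwrites (For i b c) = insert i (nwrites c)"
  by (auto simp: For_def)

lemma rwrites_For [simp]: "rwrites (For i b c) = rwrites c"
  by (simp add: For_def)

text \<open>Each iteration adds 17 to the cost of the body: 8 for the test, 1 for the sequencing, 8
  for the increment. The other 13 are the initialisation (4), the last test (8) and the outer
  \<open>Seq\<close>. The premise \<open>stable\<close> is needed because the loop itself writes the
  counter, between the end of one body and the start of the next.\<close>

lemma runs_For:
  assumes ib: "i \<noteq> b" "i \<notin> nwrites c" "b \<notin> nwrites c"
    and m: "nmem s b 0 0 = m"
    and init: "I 0 s"
    and stable: "\<And>k s' v. I k s' \<Longrightarrow> I k (s'\<lparr>nmem := upd (nmem s') i 0 0 v\<rparr>)"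
    and step: "\<And>k s'. k < m \<Longrightarrow> I k s' \<Longrightarrow> nmem s' i 0 0 = k \<Longrightarrow>
      frame (insert i (nwrites c)) (rwrites c) s s' \<Longrightarrow> runs P c s' B (I (Suc k))"
    and B': "m * (B + 17) + 13 \<le> B'"
  shows "runs P (For i b c) s B' (I m)"
proof -
  let ?inc = "nset i (NAdd (nvar i) (NConst 1))"
  let ?X = "insert i (nwrites c)" and ?Y = "rwrites c"
  let ?w = "While (NLess (nvar i) (nvar b)) (Seq c ?inc)"
  have loop: "runs P ?w s' ((m - k) * (B + 17) + 8) (I m)"
    if "k \<le> m" "I k s'" "nmem s' i 0 0 = k" "frame ?X ?Y s s'" for k s'
    using that
  proof (induction "m - k" arbitrary: k s')
    case 0
    have "nmem s' b 0 0 = m"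
      using frame_nmem[OF 0(5), of b] ib m by simp
    then have "\<not> bval (NLess (nvar i) (nvar b)) s'"
      using 0 by simp
    from exec.WhileFalse[OF this, of P "Seq c ?inc"] have "exec P ?w s' 8 s'"
      by (simp add: eval_nat_numeral)
    then show ?case
      using 0 unfolding runs_def by (intro exI[of _ 8] exI[of _ s']) simp
  next
    case (Suc d)
    have km: "k < m"
      using Suc(2) by simp
    obtain t s1 where s1: "exec P c s' t s1" "t \<le> B" "I (Suc k) s1"
      using step[OF km Suc(4,5,6)] by (auto simp: runs_def)
    have fr1: "frame ?X ?Y s s1"
      using frame_trans[OF Suc(6)] frame_mono[OF exec_frame[OF s1(1)]] by blast
    have i1: "nmem s1 i 0 0 = k"
      using frame_nmem[OF exec_frame[OF s1(1)] ib(2)] Suc(5) by simp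
    define s2 where "s2 = s1\<lparr>nmem := upd (nmem s1) i 0 0 (Suc k)\<rparr>"
    have e2: "exec P ?inc s1 8 s2"
      using exec.NSet[of P i "NConst 0" "NConst 0" "NAdd (nvar i) (NConst 1)" s1] i1
      by (simp add: s2_def eval_nat_numeral)
    have fr2: "frame ?X ?Y s s2"
      using fr1 by (simp add: s2_def frame_def upd_other)
    have "nmem s' b 0 0 = m"
      using frame_nmem[OF Suc(6), of b] ib m by simp
    then have b: "bval (NLess (nvar i) (nvar b)) s'"
      using km Suc(5) by simp
    have "runs P ?w s2 ((m - Suc k) * (B + 17) + 8) (I m)"
      by (rule Suc(1)) (use Suc(2) km stable[OF s1(3)] fr2 in \<open>auto simp: s2_def upd_apply\<close>)
    then obtain u s3 where s3: "exec P ?w s2 u s3" "u \<le> (m - Suc k) * (B + 17) + 8" "I m s3"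
      by (auto simp: runs_def)
    have "exec P ?w s' (1 + 7 + (1 + t + 8) + u) s3"
      using exec.WhileTrue[OF b exec.Seq[OF s1(1) e2] s3(1)] by simp
    moreover have "m - k = Suc (m - Suc k)"
      using km by simp
    then have "1 + 7 + (1 + t + 8) + u \<le> (m - k) * (B + 17) + 8"
      using s1(2) s3(2) by simp
    ultimately show ?case
      using s3(3) unfolding runs_def by blast
  qed
  show ?thesis
    unfolding For_def
  proof (rule runs_Seq)
    show "runs P (nset i (NConst 0)) s 4 (\<lambda>s'. s' = s\<lparr>nmem := upd (nmem s) i 0 0 0\<rparr>)"
      by (rule runs_loop_free) auto
    show "runs P ?w s' (m * (B + 17) + 8) (I m)" if "s' = s\<lparr>nmem := upd (nmem s) i 0 0 0\<rparr>" for s'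
      using loop[of 0 s'] that stable[OF init] by (simp add: upd_apply upd_other frame_def)
    show "1 + 4 + (m * (B + 17) + 8) \<le> B'"
      using B' by simp
  qed
qed

lemma lp_solverD:
  assumes "lp_solver P T" "simple_graph {..<n} E" "holds_graph s n E"
    and "0 < rmem s ''lam'' 0 0" "rmem s ''lam'' 0 0 < 1"
  shows "\<exists>t s'. exec P P s t s' \<and> t \<le> T n E \<and> lp_optimal {..<n} E (rmem s ''lam'' 0 0) (lp_output s')"
  using assms unfolding lp_solver_def by blast

lemma runs_Solve:
  assumes "lp_solver P T" "simple_graph {..<n} E" "holds_graph s n E"
    and "0 < rval a s" "rval a s < 1"
  shows "runs P (Solve a) s (1 + rcost a + T n E) (\<lambda>s'. lp_optimal {..<n} E (rval a s) (lp_output s'))"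
proof -
  let ?s = "s\<lparr>rmem := upd (rmem s) ''lam'' 0 0 (rval a s)\<rparr>"
  have "holds_graph ?s n E" "rmem ?s ''lam'' 0 0 = rval a s"
    using assms(3) by (auto simp: holds_graph_def upd_apply)
  then obtain t s' where s': "exec P P ?s t s'" "t \<le> T n E"
      "lp_optimal {..<n} E (rval a s) (lp_output s')"
    using lp_solverD[OF assms(1,2), of ?s] assms(4,5) by auto
  let ?s' = "s\<lparr>rmem := (rmem s)(''x'' := rmem s' ''x'')\<rparr>"
  have "lp_output ?s' = lp_output s'"
    by (simp add: lp_output_def fun_eq_iff)
  then show ?thesis
    using exec.Solve[OF s'(1)] s'(2,3) unfolding runs_def
    by (intro exI[of _ "1 + rcost a + t"] exI[of _ ?s']) simp
qed

section \<open>A lower bound on the running time of LP solvers\<close>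

lemma exec_changed_cells:
  assumes "exec P c s t s'" "solve_free c"
  shows "finite {(i, j). rmem s' a i j \<noteq> rmem s a i j} \<and> card {(i, j). rmem s' a i j \<noteq> rmem s a i j} \<le> t"
  using assms
proof (induction rule: exec.induct)
  case (RSet b i j p s)
  have "{(i', j'). rmem (s\<lparr>rmem := upd (rmem s) b (nval i s) (nval j s) (rval p s)\<rparr>) a i' j'
      \<noteq> rmem s a i' j'} \<subseteq> {(nval i s, nval j s)}"
    by (auto simp: upd_apply split: if_splits)
  from finite_subset[OF this] card_mono[OF _ this] show ?case by simp
next
  case (Seq c s t s' d u s'')
  have sub: "{(i, j). rmem s'' a i j \<noteq> rmem s a i j} \<subseteq>
    {(i, j). rmem s' a i j \<noteq> rmem s a i j} \<union> {(i, j). rmem s'' a i j \<noteq> rmem s' a i j}"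
    by auto
  from Seq finite_subset[OF sub] card_mono[OF _ sub] card_Un_le[of "{(i, j). rmem s' a i j \<noteq> rmem s a i j}"
      "{(i, j). rmem s'' a i j \<noteq> rmem s' a i j}"] show ?case by simp
next
  case (WhileTrue b s c t s' u s'')
  have sub: "{(i, j). rmem s'' a i j \<noteq> rmem s a i j} \<subseteq>
    {(i, j). rmem s' a i j \<noteq> rmem s a i j} \<union> {(i, j). rmem s'' a i j \<noteq> rmem s' a i j}"
    by auto
  from WhileTrue finite_subset[OF sub] card_mono[OF _ sub] card_Un_le[of "{(i, j). rmem s' a i j \<noteq> rmem s a i j}"
      "{(i, j). rmem s'' a i j \<noteq> rmem s' a i j}"] show ?case by simp
qed auto

lemma exec_time_pos: "exec P c s t s' \<Longrightarrow> 0 < t"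
  by (induction rule: exec.induct) auto

text \<open>Started with infeasible contents in the output array, the solver has to overwrite the cell
  of every pair.\<close>

lemma lp_solver_time_ge:
  assumes "lp_solver P T" "simple_graph {..<n} E"
  shows "n * n \<le> 4 * T n E" and "0 < T n E"
proof -
  let ?s = "\<lparr>nmem = (\<lambda>a i j. if a = ''n'' then n else if {i, j} \<in> E then 1 else 0),
    rmem = (\<lambda>a i j. if a = ''x'' then - 1 else 1 / 2)\<rparr>"
  have hg: "holds_graph ?s n E"
    by (simp add: holds_graph_def)
  have lam: "0 < rmem ?s ''lam'' 0 0" "rmem ?s ''lam'' 0 0 < 1"
    by simp_all
  from lp_solverD[OF assms hg lam] obtain t s' where s': "exec P P ?s t s'" "t \<le> T n E"
      "lp_optimal {..<n} E (rmem ?s ''lam'' 0 0) (lp_output s')"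
    by blast
  have sf: "solve_free P"
    using assms(1) by (simp add: lp_solver_def)
  let ?C = "{(i, j). rmem s' ''x'' i j \<noteq> rmem ?s ''x'' i j}"
  let ?pr = "\<lambda>e::nat set. (Min e, Max e)"
  have pr: "{fst (?pr e), snd (?pr e)} = e" if "e \<in> pairs {..<n}" for e
    using that unfolding pairs_def by (auto simp: card_2_iff min_def max_def not_le split: if_splits)
  have inj: "inj_on ?pr (pairs {..<n})"
    using pr by (rule inj_on_inverseI[where g = "\<lambda>p. {fst p, snd p}"])
  have "?pr ` pairs {..<n} \<subseteq> ?C"
  proof clarify
    fix e assume e: "e \<in> pairs {..<n}"
    assume "rmem s' ''x'' (Min e) (Max e) = rmem ?s ''x'' (Min e) (Max e)"
    then have "lp_output s' e = - 1"
      by (simp add: lp_output_def)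
    moreover have "0 \<le> lp_output s' e"
      using s'(3) e by (auto simp: lp_optimal_def lp_feasible_def)
    ultimately show False by simp
  qed
  then have "card (?pr ` pairs {..<n}) \<le> card ?C"
    using exec_changed_cells[OF s'(1) sf] by (intro card_mono) blast+
  then have "card (pairs {..<n}) \<le> card ?C"
    by (simp only: card_image[OF inj])
  also have "\<dots> \<le> T n E"
    using exec_changed_cells[OF s'(1) sf, of "''x''"] s'(2) by (blast intro: order_trans)
  finally have "n choose 2 \<le> T n E"
    using n_subsets[of "{..<n}" 2] by (simp add: pairs_def)
  then have 1: "n * (n - 1) div 2 \<le> T n E"
    by (simp add: choose_two)
  have 2: "1 \<le> T n E"
    using exec_time_pos[OF s'(1)] s'(2) by simp
  then show "0 < T n E"
    by simp
  show "n * n \<le> 4 * T n E"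
  \<comment> \<open>For small \<open>n\<close> the number of pairs is too small compared with
    \<open>n * n\<close>; there every run takes at least one time unit, which suffices.\<close>
  proof (cases "n \<le> 2")
    case True
    then have "n * n \<le> 2 * 2" by (intro mult_mono) auto
    then show ?thesis using 2 by simp
  next
    case False
    have "even (n * (n - 1))" by auto
    then have "n * (n - 1) \<le> 2 * T n E" using 1 by fastforce
    moreover have "n * n \<le> 2 * (n * (n - 1))"
      using mult_le_mono2[of n "2 * (n - 1)" n] False by (simp add: ac_simps)
    ultimately show ?thesis by linarith
  qed
qed

section \<open>Deterministic ball growing\<close>

text \<open>The edges are given by the symmetric 0/1 matrix \<open>a\<close> in the application, so
  double sums meet every edge twice. In \<open>growth\<close>, the left side bounds every
  \<open>ballvol\<close>; a ball that has stayed open up to radius \<rho> has \<open>ballvol\<close>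
  at least \<open>\<delta> * exp (\<alpha> * \<rho>)\<close>, which forces \<rho> to be at most
  \<open>1 / 4\<close>.\<close>

locale ball_growing =
  fixes n :: nat and a D :: "nat \<Rightarrow> nat \<Rightarrow> real" and \<alpha> \<delta> :: real
  assumes a_sym: "a i j = a j i" and a_diag: "a i i = 0" and a_ge: "0 \<le> a i j" and a_le: "a i j \<le> 1"
    and D_sym: "i < n \<Longrightarrow> j < n \<Longrightarrow> D i j = D j i" and D_diag: "i < n \<Longrightarrow> D i i = 0"
    and D_ge: "i < n \<Longrightarrow> j < n \<Longrightarrow> 0 \<le> D i j" and D_le: "i < n \<Longrightarrow> j < n \<Longrightarrow> D i j \<le> 1"
    and D_triangle: "i < n \<Longrightarrow> j < n \<Longrightarrow> k < n \<Longrightarrow> D i j \<le> D i k + D k j"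
    and \<alpha>_pos: "0 < \<alpha>" and \<delta>_pos: "0 < \<delta>"
    and growth: "\<delta> + real n ^ 2 \<le> \<delta> * exp (\<alpha> / 4)"
begin

definition cutsum :: "nat set \<Rightarrow> nat set \<Rightarrow> real" where
  "cutsum S U = (\<Sum>i\<in>S. \<Sum>j\<in>U. a i j)"

text \<open>Only the sum over pairs inside \<open>S\<close> is halved: it runs over ordered pairs,
  whereas the sum over \<open>S\<close> and \<open>U\<close> meets each edge once.\<close>

definition volume :: "nat set \<Rightarrow> nat set \<Rightarrow> real" where
  "volume S U = \<delta> + (\<Sum>i\<in>S. \<Sum>j\<in>U. a i j * D i j) + (\<Sum>i\<in>S. \<Sum>j\<in>S. a i j * D i j) / 2"

text \<open>The volume of the ball of radius \<open>\<rho>\<close> around \<open>u\<close> in the subgraph induced by \<open>R\<close>: an edge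
  contributes the part of the interval between the distances of its endpoints that lies below
  \<open>\<rho>\<close>.\<close>

definition ballvol :: "nat \<Rightarrow> nat set \<Rightarrow> real \<Rightarrow> real" where
  "ballvol u R \<rho> = \<delta> + (\<Sum>i\<in>R. \<Sum>j\<in>R. a i j * \<bar>min \<rho> (D u i) - min \<rho> (D u j)\<bar>) / 2"

lemma sum_square_Un:
  fixes g :: "nat \<Rightarrow> nat \<Rightarrow> real"
  assumes "finite S" "finite U" "S \<inter> U = {}" and sym: "\<And>i j. i \<in> S \<Longrightarrow> j \<in> U \<Longrightarrow> g i j = g j i"
  shows "(\<Sum>i\<in>S \<union> U. \<Sum>j\<in>S \<union> U. g i j) =
    (\<Sum>i\<in>S. \<Sum>j\<in>S. g i j) + 2 * (\<Sum>i\<in>S. \<Sum>j\<in>U. g i j) + (\<Sum>i\<in>U. \<Sum>j\<in>U. g i j)"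
proof -
  have "(\<Sum>i\<in>U. \<Sum>j\<in>S. g i j) = (\<Sum>i\<in>S. \<Sum>j\<in>U. g j i)"
    by (rule sum.swap)
  also have "\<dots> = (\<Sum>i\<in>S. \<Sum>j\<in>U. g i j)"
    by (intro sum.cong refl) (rule sym[symmetric])
  finally show ?thesis
    using assms by (simp add: sum.union_disjoint sum.distrib)
qed

text \<open>A radius separating \<open>S\<close> from \<open>U\<close> resolves all minima, and
  pairs inside \<open>U\<close> vanish. What remains is affine in \<rho> with slope
  \<open>cutsum S U\<close>.\<close>

lemma ballvol_split:
  assumes SU: "S \<subseteq> {..<n}" "U \<subseteq> {..<n}" "S \<inter> U = {}"
    and S: "\<And>i. i \<in> S \<Longrightarrow> D u i \<le> \<rho>" and U: "\<And>j. j \<in> U \<Longrightarrow> \<rho> \<le> D u j"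
  shows "ballvol u (S \<union> U) \<rho> =
    \<delta> + (\<Sum>i\<in>S. \<Sum>j\<in>U. a i j * (\<rho> - D u i)) + (\<Sum>i\<in>S. \<Sum>j\<in>S. a i j * \<bar>D u i - D u j\<bar>) / 2"
proof -
  have fin: "finite S" "finite U"
    using SU finite_subset by blast+
  let ?g = "\<lambda>i j. a i j * \<bar>min \<rho> (D u i) - min \<rho> (D u j)\<bar>"
  have "(\<Sum>i\<in>S. \<Sum>j\<in>S. ?g i j) = (\<Sum>i\<in>S. \<Sum>j\<in>S. a i j * \<bar>D u i - D u j\<bar>)"
    by (intro sum.cong refl) (simp add: S min_absorb2)
  moreover have "(\<Sum>i\<in>S. \<Sum>j\<in>U. ?g i j) = (\<Sum>i\<in>S. \<Sum>j\<in>U. a i j * (\<rho> - D u i))"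
    by (intro sum.cong refl) (simp add: S U min_absorb2 min_absorb1)
  moreover have "(\<Sum>i\<in>U. \<Sum>j\<in>U. ?g i j) = 0"
    by (intro sum.neutral ballI) (simp add: U min_absorb1)
  moreover have "(\<Sum>i\<in>S \<union> U. \<Sum>j\<in>S \<union> U. ?g i j) =
    (\<Sum>i\<in>S. \<Sum>j\<in>S. ?g i j) + 2 * (\<Sum>i\<in>S. \<Sum>j\<in>U. ?g i j) + (\<Sum>i\<in>U. \<Sum>j\<in>U. ?g i j)"
    by (rule sum_square_Un) (use fin SU a_sym in \<open>auto simp: abs_minus_commute\<close>)
  ultimately show ?thesis
    unfolding ballvol_def by simp
qed

lemma D_diff_le:
  assumes "u < n" "i < n" "j < n"
  shows "\<bar>D u i - D u j\<bar> \<le> D i j"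
  using D_triangle[of u i j] D_triangle[of u j i] D_sym[of i j] assms by auto

lemma ballvol_le:
  assumes "u < n" "R \<subseteq> {..<n}"
  shows "ballvol u R \<rho> \<le> \<delta> + real n ^ 2"
proof -
  have R: "card R \<le> n"
    using card_mono[OF finite_lessThan assms(2)] by simp
  have "(\<Sum>i\<in>R. \<Sum>j\<in>R. a i j * \<bar>min \<rho> (D u i) - min \<rho> (D u j)\<bar>) \<le> (\<Sum>i\<in>R. \<Sum>j\<in>R. 1)"
  proof (intro sum_mono)
    fix i j assume ij: "i \<in> R" "j \<in> R"
    then have "i < n" "j < n" using assms by auto
    then have "\<bar>min \<rho> (D u i) - min \<rho> (D u j)\<bar> \<le> 1"
      using D_diff_le[of u i j] D_le[of i j] assms(1) by (auto simp: min_def)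
    then show "a i j * \<bar>min \<rho> (D u i) - min \<rho> (D u j)\<bar> \<le> 1"
      using mult_mono[OF a_le, of _ 1] by simp
  qed
  also have "\<dots> = real (card R * card R)"
    by simp
  also have "\<dots> \<le> real n ^ 2"
    unfolding power2_eq_square of_nat_mult[symmetric] of_nat_le_iff using R by (intro mult_mono) auto
  finally show ?thesis
    unfolding ballvol_def by (smt (verit) field_sum_of_halves zero_le_power2)
qed

lemma radius_le:
  assumes "u < n" "R \<subseteq> {..<n}" "\<delta> * exp (\<alpha> * \<rho>) \<le> ballvol u R \<rho>"
  shows "\<rho> \<le> 1 / 4"
proof -
  have "\<delta> * exp (\<alpha> * \<rho>) \<le> \<delta> * exp (\<alpha> / 4)"
    using ballvol_le[OF assms(1,2)] assms(3) growth by (meson order_trans)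
  then have "\<alpha> * \<rho> \<le> \<alpha> * (1 / 4)"
    using \<delta>_pos by simp
  then show ?thesis
    using \<alpha>_pos by (simp only: mult_le_cancel_left_pos)
qed

text \<open>The derivative of \<open>ballvol\<close> in the radius is the cut, which exceeds \<open>\<alpha>\<close> times the volume as
  long as the ball is not closed; hence the exponential growth.\<close>

lemma ballvol_growth:
  assumes u: "u < n" and SU: "S \<subseteq> {..<n}" "U \<subseteq> {..<n}" "S \<inter> U = {}"
    and S: "\<And>i. i \<in> S \<Longrightarrow> D u i \<le> \<rho>" and U: "\<And>j. j \<in> U \<Longrightarrow> \<rho>' \<le> D u j" and \<rho>: "\<rho> \<le> \<rho>'"
    and fast: "\<alpha> * volume S U < cutsum S U"
    and IH: "\<delta> * exp (\<alpha> * \<rho>) \<le> ballvol u (S \<union> U) \<rho>"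
  shows "\<delta> * exp (\<alpha> * \<rho>') \<le> ballvol u (S \<union> U) \<rho>'"
proof -
  let ?G = "ballvol u (S \<union> U)"
  have G: "?G \<rho> = \<delta> + (\<Sum>i\<in>S. \<Sum>j\<in>U. a i j * (\<rho> - D u i)) + (\<Sum>i\<in>S. \<Sum>j\<in>S. a i j * \<bar>D u i - D u j\<bar>) / 2"
    by (rule ballvol_split) (use SU S U \<rho> order_trans in \<open>blast+\<close>)
  have G': "?G \<rho>' = \<delta> + (\<Sum>i\<in>S. \<Sum>j\<in>U. a i j * (\<rho>' - D u i)) + (\<Sum>i\<in>S. \<Sum>j\<in>S. a i j * \<bar>D u i - D u j\<bar>) / 2"
    by (rule ballvol_split) (use SU S U \<rho> order_trans in \<open>blast+\<close>)
  have "(\<Sum>i\<in>S. \<Sum>j\<in>U. a i j * (\<rho>' - D u i)) - (\<Sum>i\<in>S. \<Sum>j\<in>U. a i j * (\<rho> - D u i)) =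
      (\<rho>' - \<rho>) * cutsum S U"
    by (simp add: cutsum_def sum_subtractf[symmetric] sum_distrib_left algebra_simps)
  then have diff: "?G \<rho>' = ?G \<rho> + (\<rho>' - \<rho>) * cutsum S U"
    unfolding G G' by simp
  \<comment> \<open>By the triangle inequality, the part of an edge counted by
    \<open>ballvol\<close> is at most its full LP length.\<close>
  have vol: "?G \<rho>' \<le> volume S U"
  proof -
    have "a i j * (\<rho>' - D u i) \<le> a i j * D i j" if "i \<in> S" "j \<in> U" for i j
    proof -
      have "\<rho>' - D u i \<le> D i j"
        using U[OF that(2)] D_triangle[of u j i] that SU u by (smt (verit, ccfv_SIG) lessThan_iff subsetD)
      then show ?thesis by (rule mult_left_mono[OF _ a_ge])
    qed
    moreover have "a i j * \<bar>D u i - D u j\<bar> \<le> a i j * D i j" if "i \<in> S" "j \<in> S" for i j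
      by (rule mult_left_mono[OF D_diff_le a_ge]) (use that SU u in auto)
    ultimately show ?thesis
      unfolding G' volume_def by (intro add_mono divide_right_mono sum_mono order_refl) auto
  qed
  \<comment> \<open>An implicit Euler step: the slope is compared with the value at the right end,
    so that \<open>1 + y \<le> exp y\<close> at a nonpositive \<open>y\<close> gives the exponential
    without any derivative.\<close>
  have "?G \<rho> \<le> ?G \<rho>' - (\<rho>' - \<rho>) * (\<alpha> * ?G \<rho>')"
  proof -
    have "\<alpha> * ?G \<rho>' \<le> cutsum S U"
      using mult_left_mono[OF vol, of \<alpha>] \<alpha>_pos fast by linarith
    then show ?thesis
      using mult_left_mono[of "\<alpha> * ?G \<rho>'" "cutsum S U" "\<rho>' - \<rho>"] \<rho> diff by linarith
  qed
  also have "\<dots> = ?G \<rho>' * (1 + - (\<alpha> * (\<rho>' - \<rho>)))"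
    by (simp add: algebra_simps)
  also have "\<dots> \<le> ?G \<rho>' * exp (- (\<alpha> * (\<rho>' - \<rho>)))"
  proof (rule mult_left_mono[OF exp_ge_add_one_self])
    show "0 \<le> ?G \<rho>'"
      unfolding ballvol_def using \<delta>_pos a_ge by (intro add_nonneg_nonneg divide_nonneg_nonneg sum_nonneg) auto
  qed
  finally have "\<delta> * exp (\<alpha> * \<rho>) \<le> ?G \<rho>' * exp (- (\<alpha> * (\<rho>' - \<rho>)))"
    using IH by simp
  then have "\<delta> * exp (\<alpha> * \<rho>) * exp (\<alpha> * (\<rho>' - \<rho>)) \<le>
      ?G \<rho>' * exp (- (\<alpha> * (\<rho>' - \<rho>))) * exp (\<alpha> * (\<rho>' - \<rho>))"
    by (rule mult_right_mono) simp
  moreover have "\<delta> * exp (\<alpha> * \<rho>) * exp (\<alpha> * (\<rho>' - \<rho>)) = \<delta> * exp (\<alpha> * \<rho>')"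
    by (simp add: exp_add[symmetric] algebra_simps)
  moreover have "?G \<rho>' * exp (- (\<alpha> * (\<rho>' - \<rho>))) * exp (\<alpha> * (\<rho>' - \<rho>)) = ?G \<rho>'"
    by (simp add: exp_minus)
  ultimately show ?thesis by simp
qed

lemma cutsum_insert:
  assumes "finite S" "finite U" "w \<in> U" "w \<notin> S"
  shows "cutsum (insert w S) (U - {w}) = cutsum S U + (\<Sum>j\<in>U - {w}. a w j) - (\<Sum>j\<in>S. a w j)"
proof -
  have "cutsum S U = cutsum S (U - {w}) + (\<Sum>i\<in>S. a i w)"
    unfolding cutsum_def sum.distrib[symmetric]
    by (intro sum.cong refl) (use assms sum.remove[of U w] in \<open>simp add: add.commute\<close>)
  moreover have "(\<Sum>i\<in>S. a i w) = (\<Sum>j\<in>S. a w j)"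
    by (intro sum.cong refl a_sym)
  ultimately show ?thesis
    using assms by (simp add: cutsum_def)
qed

text \<open>Edges between \<open>w\<close> and \<open>S\<close> were counted in full when their
  endpoint in \<open>S\<close> joined; they only move from the cut part to the inner part. New are
  the edges from \<open>w\<close> to the vertices that remain outside.\<close>

lemma volume_insert:
  assumes "finite S" "finite U" "w \<in> U" "w \<notin> S" "S \<subseteq> {..<n}" "U \<subseteq> {..<n}"
  shows "volume (insert w S) (U - {w}) = volume S U + (\<Sum>j\<in>U - {w}. a w j * D w j)"
proof -
  let ?g = "\<lambda>i j. a i j * D i j"
  have 1: "(\<Sum>i\<in>S. \<Sum>j\<in>U. ?g i j) = (\<Sum>i\<in>S. \<Sum>j\<in>U - {w}. ?g i j) + (\<Sum>i\<in>S. ?g i w)"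
    unfolding sum.distrib[symmetric]
    by (intro sum.cong refl) (use assms sum.remove[of U w] in \<open>simp add: add.commute\<close>)
  have 2: "(\<Sum>i\<in>S \<union> {w}. \<Sum>j\<in>S \<union> {w}. ?g i j) =
      (\<Sum>i\<in>S. \<Sum>j\<in>S. ?g i j) + 2 * (\<Sum>i\<in>S. \<Sum>j\<in>{w}. ?g i j) + (\<Sum>i\<in>{w}. \<Sum>j\<in>{w}. ?g i j)"
  proof (rule sum_square_Un)
    show "?g i j = ?g j i" if "i \<in> S" "j \<in> {w}" for i j
      using that assms D_sym[of i j] a_sym[of i j] by auto
  qed (use assms in auto)
  have 3: "(\<Sum>i\<in>insert w S. \<Sum>j\<in>U - {w}. ?g i j) = (\<Sum>j\<in>U - {w}. ?g w j) + (\<Sum>i\<in>S. \<Sum>j\<in>U - {w}. ?g i j)"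
    using assms by simp
  show ?thesis
    unfolding volume_def 1 3 using 2 a_diag by simp
qed

section \<open>The invariant of ball growing and the charging argument\<close>

definition unassigned :: "(nat \<Rightarrow> nat) \<Rightarrow> nat set" where
  "unassigned f = {j. j < n \<and> f j = 0}"

definition members :: "(nat \<Rightarrow> nat) \<Rightarrow> nat \<Rightarrow> nat set" where
  "members f c = {j. j < n \<and> f j = c}"

text \<open>The amount by which cutting the pair exceeds its budget of \<alpha> times its LP length.
  The final cut bound says that all charges together are at most
  \<open>2 * \<alpha> * \<delta> * n\<close>.\<close>

definition charge :: "(nat \<Rightarrow> nat) \<Rightarrow> nat \<Rightarrow> nat \<Rightarrow> real" where
  "charge f i j = a i j * (of_bool (f i \<noteq> f j) - \<alpha> * D i j)"

text \<open>\<open>R\<close> will consist of the current ball and the unassigned vertices. Whether a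
  pair inside \<open>R\<close> is cut is not settled yet, so these pairs are left out.\<close>

definition outer_charge :: "(nat \<Rightarrow> nat) \<Rightarrow> nat set \<Rightarrow> real" where
  "outer_charge f R = (\<Sum>i<n. \<Sum>j<n. if i \<in> R \<and> j \<in> R then 0 else charge f i j)"

text \<open>The state after \<open>m\<close> vertices have received a (nonzero) label: \<open>c\<close> is the label of the
  current ball and \<open>u\<close> its centre; the clusters with other labels are final.\<close>

definition ball_inv :: "nat \<Rightarrow> (nat \<Rightarrow> nat) \<Rightarrow> nat \<Rightarrow> nat \<Rightarrow> real \<Rightarrow> real \<Rightarrow> bool" where
  "ball_inv m f c u k v \<longleftrightarrow>
     card (unassigned f) + m = n \<and> 0 < c \<and> (\<forall>i<n. f i \<le> m) \<and> (0 < n \<longrightarrow> u < n) \<and>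
     k = cutsum (members f c) (unassigned f) \<and> v = volume (members f c) (unassigned f) \<and>
     (\<exists>\<rho>\<ge>0. (\<forall>i\<in>members f c. D u i \<le> \<rho>) \<and> (\<forall>j\<in>unassigned f. \<rho> \<le> D u j) \<and>
        \<delta> * exp (\<alpha> * \<rho>) \<le> ballvol u (members f c \<union> unassigned f) \<rho>) \<and>
     outer_charge f (members f c \<union> unassigned f) \<le>
       2 * \<alpha> * \<delta> * (real n - card (members f c \<union> unassigned f)) \<and>
     (\<forall>i<n. \<forall>j<n. f i = f j \<and> f i \<noteq> 0 \<longrightarrow> D i j \<le> 1 / 2)"

lemma outer_charge_complement:
  assumes "R \<subseteq> {..<n}"
  shows "outer_charge f R = (\<Sum>i<n. \<Sum>j<n. charge f i j) - (\<Sum>i\<in>R. \<Sum>j\<in>R. charge f i j)"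
proof -
  have "(\<Sum>i\<in>R. \<Sum>j\<in>R. charge f i j) = (\<Sum>i<n. \<Sum>j<n. if i \<in> R \<and> j \<in> R then charge f i j else 0)"
  proof -
    have "(\<Sum>j<n. if i \<in> R \<and> j \<in> R then charge f i j else 0) = (if i \<in> R then \<Sum>j\<in>R. charge f i j else 0)" for i
    proof (cases "i \<in> R")
      case True
      have "(\<Sum>j<n. if j \<in> R then charge f i j else 0) = (\<Sum>j\<in>{..<n} \<inter> R. charge f i j)"
        by (simp add: sum.inter_restrict)
      then show ?thesis using True assms by (simp add: Int_absorb1)
    qed simp
    moreover have "(\<Sum>i<n. if i \<in> R then \<Sum>j\<in>R. charge f i j else 0) = (\<Sum>i\<in>{..<n} \<inter> R. \<Sum>j\<in>R. charge f i j)"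
      by (simp add: sum.inter_restrict)
    ultimately show ?thesis using assms by (simp add: Int_absorb1)
  qed
  then show ?thesis
    unfolding outer_charge_def by (simp only: sum_subtractf[symmetric])
      (intro sum.cong refl, simp)
qed

lemma members_unassigned:
  "finite (members f c)" "finite (unassigned f)" "members f c \<subseteq> {..<n}" "unassigned f \<subseteq> {..<n}"
  "0 < c \<Longrightarrow> members f c \<inter> unassigned f = {}"
  by (auto simp: members_def unassigned_def)

lemma ball_inv_initial:
  assumes "\<And>i. i < n \<Longrightarrow> f i = 0"
  shows "ball_inv 0 f 1 0 0 \<delta>"
proof -
  have *: "unassigned f = {..<n}" "members f 1 = {}"
    using assms by (auto simp: unassigned_def members_def)
  have "ballvol 0 {..<n} 0 = \<delta>"
    using ballvol_split[of "{}" "{..<n}" 0 0] D_ge by (cases "n = 0") auto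
  moreover have "outer_charge f {..<n} = 0"
    by (simp add: outer_charge_def)
  moreover have "\<forall>j\<in>{..<n}. 0 \<le> D 0 j"
    using D_ge by (cases "n = 0") auto
  ultimately show ?thesis
    unfolding ball_inv_def * using assms
    by (intro conjI exI[of _ 0]) (simp_all add: cutsum_def volume_def)
qed

text \<open>Closing settles the pairs that touch \<open>?S\<close>. Their charges sum to
  \<open>2 * k - 2 * \<alpha> * (v - \<delta>)\<close>, at most
  \<open>2 * \<alpha> * \<delta>\<close> by the closing test: every cluster overdraws its budget by
  one seed, which is paid by one of its vertices. All labels in use are at most \<open>m\<close>, so
  \<open>Suc m\<close> is fresh.\<close>

lemma ball_inv_close:
  assumes inv: "ball_inv m f c u k v" and closed: "k \<le> \<alpha> * v" and u': "u' < n"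
  shows "ball_inv m f (Suc m) u' 0 \<delta>"
proof -
  let ?S = "members f c" and ?U = "unassigned f"
  from inv have c: "0 < c" and le: "\<forall>i<n. f i \<le> m" and k: "k = cutsum ?S ?U" and v: "v = volume ?S ?U"
    and ch: "outer_charge f (?S \<union> ?U) \<le> 2 * \<alpha> * \<delta> * (real n - card (?S \<union> ?U))"
    unfolding ball_inv_def by auto
  note mu = members_unassigned(1)[of f c] members_unassigned(2)[of f] members_unassigned(3)[of f c]
    members_unassigned(4)[of f] members_unassigned(5)[OF c, of f]
  have emp: "members f (Suc m) = {}"
    using le not_less_eq_eq by (auto simp: members_def)
  have "ballvol u' ?U 0 = \<delta>"
    using ballvol_split[of "{}" ?U u' 0] mu D_ge[OF u'] by auto
  moreover have "outer_charge f ?U \<le> 2 * \<alpha> * \<delta> * (real n - card ?U)"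
  proof (cases "?S = {}")
    \<comment> \<open>This happens before the first vertex is labelled: the empty ball passes the
      test as well, but has no vertex to pay a seed and needs none.\<close>
    case True
    then show ?thesis using ch by simp
  next
    case False
    then have card: "1 \<le> card ?S"
      using mu(1) by (simp add: Suc_le_eq card_gt_0_iff)
    have cU: "card (?S \<union> ?U) = card ?S + card ?U"
      using mu c by (simp add: card_Un_disjoint)
    have "(\<Sum>i\<in>?S \<union> ?U. \<Sum>j\<in>?S \<union> ?U. charge f i j) =
      (\<Sum>i\<in>?S. \<Sum>j\<in>?S. charge f i j) + 2 * (\<Sum>i\<in>?S. \<Sum>j\<in>?U. charge f i j) + (\<Sum>i\<in>?U. \<Sum>j\<in>?U. charge f i j)"
      by (rule sum_square_Un) (use mu c a_sym D_sym in \<open>auto simp: charge_def subset_iff\<close>)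
    moreover have "(\<Sum>i\<in>?S. \<Sum>j\<in>?S. charge f i j) = - \<alpha> * (\<Sum>i\<in>?S. \<Sum>j\<in>?S. a i j * D i j)"
      unfolding sum_distrib_left by (intro sum.cong refl) (auto simp: charge_def members_def)
    moreover have "(\<Sum>i\<in>?S. \<Sum>j\<in>?U. charge f i j) = k - \<alpha> * (\<Sum>i\<in>?S. \<Sum>j\<in>?U. a i j * D i j)"
      unfolding k cutsum_def sum_distrib_left sum_subtractf[symmetric]
      by (intro sum.cong refl) (use c in \<open>auto simp: charge_def members_def unassigned_def algebra_simps\<close>)
    ultimately have "(\<Sum>i\<in>?S \<union> ?U. \<Sum>j\<in>?S \<union> ?U. charge f i j) - (\<Sum>i\<in>?U. \<Sum>j\<in>?U. charge f i j) =
        2 * k - 2 * \<alpha> * (v - \<delta>)"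
      unfolding v volume_def by (simp add: algebra_simps)
    then have "outer_charge f ?U = outer_charge f (?S \<union> ?U) + 2 * k - 2 * \<alpha> * (v - \<delta>)"
      using outer_charge_complement[of ?U f] outer_charge_complement[of "?S \<union> ?U" f] mu by simp
    also have "\<dots> \<le> 2 * \<alpha> * \<delta> * (real n - card (?S \<union> ?U)) + 2 * \<alpha> * \<delta> * 1"
      using ch closed by (simp add: algebra_simps)
    also have "\<dots> \<le> 2 * \<alpha> * \<delta> * (real n - card (?S \<union> ?U)) + 2 * \<alpha> * \<delta> * card ?S"
      by (intro add_left_mono mult_left_mono) (use card \<alpha>_pos \<delta>_pos in auto)
    finally show ?thesis
      unfolding cU by (simp add: algebra_simps)
  qed
  moreover have "0 \<le> D u' j" if "j \<in> ?U" for j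
    using that D_ge[OF u'] by (simp add: unassigned_def)
  moreover have "card ?U + m = n" "\<forall>i<n. \<forall>j<n. f i = f j \<and> f i \<noteq> 0 \<longrightarrow> D i j \<le> 1 / 2"
    using inv by (simp_all add: ball_inv_def)
  ultimately show ?thesis
    unfolding ball_inv_def emp using u' le
    by (intro conjI exI[of _ 0]) (simp_all add: cutsum_def volume_def)
qed

text \<open>A fresh ball has its centre among the unassigned vertices, so its first member is at
  distance \<open>0\<close>, although it need not be the centre itself.\<close>

lemma ball_inv_add:
  assumes inv: "ball_inv m f c u k v" and w: "w \<in> unassigned f"
    and closest: "\<And>j. j \<in> unassigned f \<Longrightarrow> D u w \<le> D u j"
    and step: "\<alpha> * v < k \<or> (members f c = {} \<and> u \<in> unassigned f \<and> c \<le> Suc m)"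
  defines "f' \<equiv> f(w := c)"
  shows "ball_inv (Suc m) f' c u
    (k + (\<Sum>j\<in>unassigned f'. a w j) - (\<Sum>j\<in>members f' c. a w j))
    (v + (\<Sum>j\<in>unassigned f'. a w j * D w j))"
proof -
  let ?S = "members f c" and ?U = "unassigned f"
  from inv have c: "0 < c" and le: "\<forall>i<n. f i \<le> m" and k: "k = cutsum ?S ?U" and v: "v = volume ?S ?U"
    and ch: "outer_charge f (?S \<union> ?U) \<le> 2 * \<alpha> * \<delta> * (real n - card (?S \<union> ?U))"
    and card: "card ?U + m = n"
    and half: "\<forall>i<n. \<forall>j<n. f i = f j \<and> f i \<noteq> 0 \<longrightarrow> D i j \<le> 1 / 2"
    unfolding ball_inv_def by auto
  from inv obtain \<rho> where \<rho>: "0 \<le> \<rho>" "\<And>i. i \<in> ?S \<Longrightarrow> D u i \<le> \<rho>" "\<And>j. j \<in> ?U \<Longrightarrow> \<rho> \<le> D u j"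
      "\<delta> * exp (\<alpha> * \<rho>) \<le> ballvol u (?S \<union> ?U) \<rho>"
    unfolding ball_inv_def by auto
  note mu = members_unassigned(1)[of f c] members_unassigned(2)[of f] members_unassigned(3)[of f c]
    members_unassigned(4)[of f] members_unassigned(5)[OF c, of f]
  have wn: "w < n" "f w = 0"
    using w by (auto simp: unassigned_def)
  have un: "u < n"
    using inv wn by (auto simp: ball_inv_def)
  have wS: "w \<notin> ?S"
    using wn c by (auto simp: members_def)
  have S': "members f' c = insert w ?S"
    using wn by (auto simp: f'_def members_def)
  have U': "unassigned f' = ?U - {w}"
    using c by (auto simp: f'_def unassigned_def)
  have R: "members f' c \<union> unassigned f' = ?S \<union> ?U"
    unfolding S' U' using w by auto
  have sumS: "(\<Sum>j\<in>members f' c. a w j) = (\<Sum>j\<in>?S. a w j)"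
    unfolding S' using mu wS by (simp add: a_diag)
  let ?\<rho> = "D u w"
  have Su: "D u i \<le> ?\<rho>" if "i \<in> ?S" for i
    using \<rho>(2)[OF that] \<rho>(3)[OF w] by simp
  \<comment> \<open>An open ball grows up to the distance of \<open>w\<close>; a fresh ball still
    has radius 0, where both sides equal \<delta>.\<close>
  have vol': "\<delta> * exp (\<alpha> * ?\<rho>) \<le> ballvol u (?S \<union> ?U) ?\<rho>"
    using step
  proof
    assume "\<alpha> * v < k"
    then show ?thesis
      by (intro ballvol_growth[OF un mu(3,4) _ \<rho>(2) closest \<rho>(3)[OF w] _ \<rho>(4)])
        (use mu(5) k v in auto)
  next
    assume *: "?S = {} \<and> u \<in> ?U \<and> c \<le> Suc m"
    then have "D u w = 0"
      using closest[of u] D_diag[OF un] D_ge[OF un wn(1)] by simp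
    moreover from * have "ballvol u ?U 0 = \<delta>"
      using ballvol_split[of "{}" ?U u 0] mu D_ge[OF un] by auto
    ultimately show ?thesis using * by simp
  qed
  have rad: "?\<rho> \<le> 1 / 4"
    by (rule radius_le[OF un _ vol']) (use mu in auto)
  have half': "D w i \<le> 1 / 2" "D i w \<le> 1 / 2" if "i \<in> insert w ?S" for i
  proof -
    have "i < n" "D u i \<le> 1 / 4"
      using that Su[of i] rad wn mu(3) by auto
    then show "D w i \<le> 1 / 2" "D i w \<le> 1 / 2"
      using D_triangle[of w i u] D_sym[of w u] D_sym[of w i] rad wn un by auto
  qed
  have "card ?U = Suc (card (?U - {w}))"
    by (rule card.remove) (use mu w in auto)
  then have 1: "card (unassigned f') + Suc m = n"
    using card by (simp add: U')
  \<comment> \<open>This keeps all labels at most \<open>Suc m\<close> after the assignment. An open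
    ball is nonempty, as the empty one has cut 0 and positive volume \<delta>; any member then shows
    that \<open>c\<close> is already in use and at most \<open>m\<close>.\<close>
  have "c \<le> Suc m"
    using step
  proof
    assume *: "\<alpha> * v < k"
    have "?S \<noteq> {}"
    proof
      assume "?S = {}"
      then have "k = 0" "v = \<delta>"
        unfolding k v by (simp_all add: cutsum_def volume_def)
      then show False
        using * \<alpha>_pos \<delta>_pos by (simp add: mult_less_0_iff)
    qed
    then show ?thesis
      using le by (auto simp: members_def)
  qed simp
  then have 2: "\<forall>i<n. f' i \<le> Suc m"
    using le by (auto simp: f'_def le_Suc_eq)
  have 3: "k + (\<Sum>j\<in>unassigned f'. a w j) - (\<Sum>j\<in>members f' c. a w j) = cutsum (members f' c) (unassigned f')"
    unfolding sumS unfolding k S' U' using cutsum_insert[OF mu(1,2) w wS] by simp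
  have 4: "v + (\<Sum>j\<in>unassigned f'. a w j * D w j) = volume (members f' c) (unassigned f')"
    unfolding v S' U' using volume_insert[OF mu(1,2) w wS mu(3,4)] by simp
  \<comment> \<open>If \<open>w\<close> is paired with a vertex outside this set, that vertex has a
    final label, different both from 0 and from \<open>c\<close>. The pair is cut before and
    after.\<close>
  have 5: "outer_charge f' (?S \<union> ?U) = outer_charge f (?S \<union> ?U)"
    unfolding outer_charge_def
  proof (intro sum.cong refl if_cong)
    fix i j assume *: "i \<in> {..<n}" "j \<in> {..<n}" "\<not> (i \<in> ?S \<union> ?U \<and> j \<in> ?S \<union> ?U)"
    then have "(f' i \<noteq> f' j) = (f i \<noteq> f j)"
      using wn by (auto simp: f'_def members_def unassigned_def)
    then show "charge f' i j = charge f i j"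
      by (simp add: charge_def)
  qed
  have 6: "D i j \<le> 1 / 2" if ij: "i < n" "j < n" "f' i = f' j" "f' i \<noteq> 0" for i j
  proof (cases "i = w \<or> j = w")
    case True
    then have "i \<in> insert w ?S \<and> j \<in> insert w ?S"
      using ij by (auto simp: f'_def members_def split: if_splits)
    then show ?thesis
      using True half' by blast
  next
    case False
    then show ?thesis
      using half ij by (simp add: f'_def)
  qed
  show ?thesis
    unfolding ball_inv_def 3 4 R 5
  proof (intro conjI exI[of _ ?\<rho>])
    show "\<forall>i\<in>members f' c. D u i \<le> ?\<rho>"
      using Su unfolding S' by simp
    show "\<forall>j\<in>unassigned f'. ?\<rho> \<le> D u j"
      using closest unfolding U' by simp
    show "\<forall>i<n. \<forall>j<n. f' i = f' j \<and> f' i \<noteq> 0 \<longrightarrow> D i j \<le> 1 / 2"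
      using 6 by blast
  qed (use 1 2 c un ch vol' D_ge[OF un wn(1)] in simp_all)
qed

text \<open>The last ball is never closed, but nothing is left outside of it: its inner pairs are
  uncut and have nonpositive charge, so including them preserves the bound.\<close>

lemma ball_inv_final:
  assumes inv: "ball_inv n f c u k v"
  shows "(\<Sum>i<n. \<Sum>j<n. a i j * of_bool (f i \<noteq> f j)) \<le> \<alpha> * (2 * real n * \<delta> + (\<Sum>i<n. \<Sum>j<n. a i j * D i j))"
    and "\<And>i j. i < n \<Longrightarrow> j < n \<Longrightarrow> f i = f j \<Longrightarrow> D i j \<le> 1 / 2"
proof -
  from inv have "card (unassigned f) = 0" by (simp add: ball_inv_def)
  then have U: "unassigned f = {}"
    using members_unassigned(2) by simp
  let ?S = "members f c"
  have "outer_charge f ?S \<le> 2 * \<alpha> * \<delta> * (real n - card ?S)"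
    using inv U by (simp add: ball_inv_def)
  also have "\<dots> \<le> 2 * \<alpha> * \<delta> * real n"
    using \<alpha>_pos \<delta>_pos by (intro mult_left_mono) auto
  finally have o: "outer_charge f ?S \<le> 2 * \<alpha> * \<delta> * real n" .
  have "(\<Sum>i\<in>?S. \<Sum>j\<in>?S. charge f i j) \<le> 0"
    using \<alpha>_pos D_ge a_ge
    by (intro sum_nonpos) (auto simp: charge_def members_def mult_nonneg_nonpos)
  then have "(\<Sum>i<n. \<Sum>j<n. charge f i j) \<le> 2 * \<alpha> * \<delta> * real n"
    using o outer_charge_complement[OF members_unassigned(3)] by simp
  moreover have "(\<Sum>i<n. \<Sum>j<n. charge f i j) =
      (\<Sum>i<n. \<Sum>j<n. a i j * of_bool (f i \<noteq> f j)) - \<alpha> * (\<Sum>i<n. \<Sum>j<n. a i j * D i j)"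
    unfolding sum_distrib_left sum_subtractf[symmetric]
    by (intro sum.cong refl) (simp add: charge_def algebra_simps)
  ultimately show "(\<Sum>i<n. \<Sum>j<n. a i j * of_bool (f i \<noteq> f j)) \<le>
      \<alpha> * (2 * real n * \<delta> + (\<Sum>i<n. \<Sum>j<n. a i j * D i j))"
    by (simp add: algebra_simps)
  show "D i j \<le> 1 / 2" if "i < n" "j < n" "f i = f j" for i j
  proof -
    have "f i \<noteq> 0" using U that by (auto simp: unassigned_def)
    then show ?thesis using inv that unfolding ball_inv_def by blast
  qed
qed

end

section \<open>Clusterings and the LP relaxation\<close>

text \<open>The integral LP solution that belongs to the clustering \<open>C\<close>.\<close>

definition sep :: "'a set set \<Rightarrow> 'a set \<Rightarrow> real" where
  "sep C e = (if \<exists>S\<in>C. e \<subseteq> S then 0 else 1)"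

lemma sep_cases: "sep C e = 0 \<or> sep C e = 1"
  by (simp add: sep_def)

lemma sep_bounds: "0 \<le> sep C e" "sep C e \<le> 1"
  by (simp_all add: sep_def)

lemma finite_pairs: "finite V \<Longrightarrow> finite (pairs V)"
  by (simp add: pairs_def)

lemma sum_partition_single:
  assumes "finite V" "partition_on V C" "v \<in> V"
  shows "(\<Sum>S\<in>C. of_bool (v \<in> S)) = (1::real)"
proof -
  obtain S where S: "S \<in> C" "v \<in> S"
    using assms by (auto simp: partition_on_def)
  have fin: "finite C"
    using finite_elements assms by blast
  have "(v \<in> S') = (S' = S)" if "S' \<in> C" for S'
    using that S assms(2) unfolding partition_on_def disjoint_def by blast
  then have "(\<Sum>S'\<in>C. of_bool (v \<in> S')) = (\<Sum>S'\<in>C. of_bool (S' = S) :: real)"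
    by (intro sum.cong) auto
  also have "\<dots> = 1"
    using fin S(1) by (simp add: of_bool_def sum.delta')
  finally show ?thesis .
qed

lemma sum_partition_pair:
  assumes "finite V" "partition_on V C" "e \<in> pairs V"
  shows "(\<Sum>S\<in>C. of_bool (e \<subseteq> S)) = 1 - sep C e"
proof (cases "\<exists>S\<in>C. e \<subseteq> S")
  case True
  then obtain S where S: "S \<in> C" "e \<subseteq> S" by blast
  obtain v w where e: "e = {v, w}" "v \<in> V"
    using assms(3) by (auto simp: pairs_def card_2_iff)
  have "(e \<subseteq> S') = (v \<in> S')" if "S' \<in> C" for S'
    using that S assms(2) e unfolding partition_on_def disjoint_def by blast
  then have "(\<Sum>S'\<in>C. of_bool (e \<subseteq> S')) = (\<Sum>S'\<in>C. of_bool (v \<in> S') :: real)"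
    by (intro sum.cong) auto
  also have "\<dots> = 1"
    by (rule sum_partition_single[OF assms(1,2) e(2)])
  finally show ?thesis
    using True by (simp add: sep_def)
qed (simp add: sep_def)

text \<open>Inclusion-exclusion on the two endpoints. A separated edge is seen from the clusters of
  both endpoints; this 2 cancels the factor \<open>1/2\<close> in \<open>LamPrime\<close>.\<close>

lemma sum_partition_cut:
  assumes "finite V" "partition_on V C" "e \<in> pairs V"
  shows "(\<Sum>S\<in>C. of_bool (card (e \<inter> S) = 1)) = 2 * sep C e"
proof -
  obtain v w where e: "e = {v, w}" "v \<in> V" "w \<in> V" "v \<noteq> w"
    using assms(3) by (auto simp: pairs_def card_2_iff)
  have "of_bool (card (e \<inter> S) = 1) = of_bool (v \<in> S) + of_bool (w \<in> S) - 2 * (of_bool (e \<subseteq> S) :: real)" for S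
    using e by (cases "v \<in> S"; cases "w \<in> S") (auto simp: Int_insert_left)
  then have "(\<Sum>S\<in>C. of_bool (card (e \<inter> S) = 1)) =
      (\<Sum>S\<in>C. of_bool (v \<in> S)) + (\<Sum>S\<in>C. of_bool (w \<in> S)) - 2 * (\<Sum>S\<in>C. of_bool (e \<subseteq> S) :: real)"
    by (simp add: sum.distrib sum_subtractf sum_distrib_left)
  then show ?thesis
    using sum_partition_single[OF assms(1,2) e(2)] sum_partition_single[OF assms(1,2) e(3)]
      sum_partition_pair[OF assms] by simp
qed

lemma LamPrime_eq_lp_objective:
  assumes V: "finite V" and E: "E \<subseteq> pairs V" and C: "partition_on V C"
  shows "LamPrime E C l = lp_objective V E l (sep C)"
proof -
  have fin: "finite C" "finite E"
    using finite_elements[OF V C] finite_subset[OF E finite_pairs[OF V]] by auto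
  have "real (cut E S) = (\<Sum>e\<in>E. of_bool (card (e \<inter> S) = 1))" for S
    using fin(2) by (simp add: cut_def of_bool_def sum.If_cases Int_def)
  then have "(\<Sum>S\<in>C. real (cut E S)) = (\<Sum>e\<in>E. \<Sum>S\<in>C. of_bool (card (e \<inter> S) = 1))"
    by (simp add: sum.swap[of _ C])
  also have "\<dots> = (\<Sum>e\<in>E. 2 * sep C e)"
    by (intro sum.cong refl sum_partition_cut[OF V C]) (use E in auto)
  finally have 1: "(\<Sum>S\<in>C. 1 / 2 * real (cut E S)) = (\<Sum>e\<in>E. sep C e)"
    by (simp add: sum_distrib_left[symmetric] sum_divide_distrib[symmetric])
  have "real (card S choose 2) = (\<Sum>e\<in>pairs V. of_bool (e \<subseteq> S))" if "S \<in> C" for S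
  proof -
    have S: "S \<subseteq> V" using C that by (auto simp: partition_on_def)
    then have "{e. e \<subseteq> S \<and> card e = 2} = pairs V \<inter> {e. e \<subseteq> S}"
      by (auto simp: pairs_def)
    moreover have "card {e. e \<subseteq> S \<and> card e = 2} = card S choose 2"
      by (rule n_subsets[OF finite_subset[OF S V]])
    ultimately show ?thesis
      using finite_pairs[OF V] by (simp add: of_bool_def sum.If_cases)
  qed
  then have "(\<Sum>S\<in>C. real (card S choose 2)) = (\<Sum>S\<in>C. \<Sum>e\<in>pairs V. of_bool (e \<subseteq> S))"
    by simp
  also have "\<dots> = (\<Sum>e\<in>pairs V. \<Sum>S\<in>C. of_bool (e \<subseteq> S))"
    by (rule sum.swap)
  also have "\<dots> = (\<Sum>e\<in>pairs V. 1 - sep C e)"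
    by (intro sum.cong refl sum_partition_pair[OF V C])
  finally have 2: "(\<Sum>S\<in>C. real (card S choose 2)) = (\<Sum>e\<in>pairs V. 1 - sep C e)" .
  show ?thesis
    unfolding LamPrime_def lp_objective_def sum.distrib 1 using 2 by (simp add: sum_distrib_left[symmetric])
qed

lemma lp_feasible_sep:
  assumes C: "partition_on V C"
  shows "lp_feasible V (sep C)"
proof -
  have "sep C {i, j} \<le> sep C {i, k} + sep C {j, k}" for i j k
  proof (cases "(\<exists>S\<in>C. {i, k} \<subseteq> S) \<and> (\<exists>S\<in>C. {j, k} \<subseteq> S)")
    case True
    then obtain S S' where S: "S \<in> C" "i \<in> S" "k \<in> S" "S' \<in> C" "j \<in> S'" "k \<in> S'"
      by auto
    then have "S = S'"
      using partition_onD2[OF C] by (auto dest: disjointD)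
    then have "sep C {i, j} = 0"
      using S unfolding sep_def by auto
    then show ?thesis
      using sep_bounds[of C] by simp
  next
    case False
    then have "1 \<le> sep C {i, k} + sep C {j, k}"
      unfolding sep_def by auto
    then show ?thesis
      using sep_bounds(2)[of C "{i, j}"] by linarith
  qed
  then show ?thesis
    using sep_bounds[of C] by (simp add: lp_feasible_def)
qed

lemma lp_optimal_le_LamPrime:
  assumes "simple_graph V E" "lp_optimal V E l x" "partition_on V C"
  shows "lp_objective V E l x \<le> LamPrime E C l"
  using assms lp_feasible_sep[OF assms(3)] LamPrime_eq_lp_objective[of V E C l]
  unfolding lp_optimal_def simple_graph_def by simp

text \<open>The additive term \<open>l\<close> in the first hypothesis is affordable because every edge contributes
  \<open>x e + l * (1 - x e) \<ge> l\<close> to the LP objective.\<close>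

lemma LamPrime_le_lp_objective:
  assumes G: "simple_graph V E" and l: "0 < l" "l \<le> 1" and x: "lp_feasible V x"
    and C: "partition_on V C" and \<alpha>: "0 \<le> \<alpha>"
    and cut: "(\<Sum>e\<in>E. sep C e) \<le> \<alpha> * (l + (\<Sum>e\<in>E. x e))"
    and near: "\<And>e. e \<in> pairs V \<Longrightarrow> sep C e = 0 \<Longrightarrow> x e \<le> 1 / 2"
  shows "LamPrime E C l \<le> (2 * \<alpha> + 2) * lp_objective V E l x"
proof -
  have V: "finite V" and E: "E \<subseteq> pairs V" "finite E" and fp: "finite (pairs V)"
    using G finite_pairs[of V] finite_subset[of E "pairs V"] by (auto simp: simple_graph_def)
  have x01: "0 \<le> x e" "x e \<le> 1" if "e \<in> pairs V" for e
    using x that by (auto simp: lp_feasible_def)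
  let ?A = "\<Sum>e\<in>E. x e" and ?B = "\<Sum>e\<in>pairs V. l * (1 - x e)"
  have A: "0 \<le> ?A" and B: "0 \<le> ?B"
    using x01 E l by (auto intro!: sum_nonneg)
  have "(\<Sum>e\<in>E. sep C e) \<le> 2 * \<alpha> * (?A + ?B)"
  proof (cases "E = {}")
    case True
    then show ?thesis using \<alpha> B by simp
  next
    case False
    then obtain e where e: "e \<in> E" "e \<in> pairs V" using E by blast
    have "x e \<le> ?A"
      using e E x01 by (intro member_le_sum) auto
    moreover have "l * (1 - x e) \<le> ?B"
      using e fp x01 l by (intro member_le_sum[where f="\<lambda>e. l * (1 - x e)"]) auto
    moreover have "l \<le> x e + l * (1 - x e)"
      using x01(1)[OF e(2)] l mult_right_mono[of l 1 "x e"] by (simp add: algebra_simps)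
    ultimately have "l \<le> ?A + ?B"
      by (meson add_mono order_trans)
    then have "l + ?A \<le> ?A + ?B + (?A + ?B)"
      using B by (intro add_mono) simp_all
    then have "l + ?A \<le> 2 * (?A + ?B)"
      by simp
    then have "\<alpha> * (l + ?A) \<le> \<alpha> * (2 * (?A + ?B))"
      using \<alpha> by (rule mult_left_mono)
    moreover have "\<alpha> * (2 * (?A + ?B)) = 2 * \<alpha> * (?A + ?B)"
      by simp
    ultimately show ?thesis using cut by linarith
  qed
  moreover have "(\<Sum>e\<in>pairs V. l * (1 - sep C e)) \<le> 2 * ?B"
    unfolding sum_distrib_left
  proof (intro sum_mono)
    fix e assume e: "e \<in> pairs V"
    \<comment> \<open>Only uncut pairs matter; they have \<open>x e\<close> at most
      \<open>1 / 2\<close>, so the LP already pays half of their cost.\<close>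
    have "1 - sep C e \<le> 2 * (1 - x e)"
      using near[OF e] x01[OF e] sep_cases[of C e] by auto
    then have "l * (1 - sep C e) \<le> l * (2 * (1 - x e))"
      using l by (intro mult_left_mono) auto
    then show "l * (1 - sep C e) \<le> 2 * (l * (1 - x e))" by (simp only: mult.left_commute)
  qed
  moreover have "2 * ?B \<le> 2 * (?A + ?B)"
    using A by simp
  ultimately show ?thesis
    unfolding LamPrime_eq_lp_objective[OF V E(1) C] unfolding lp_objective_def
    by (simp add: algebra_simps)
qed

lemma partition_on_clustering_of_labels: "partition_on {..<n} (clustering_of_labels n f)"
  by (auto simp: partition_on_def disjoint_def clustering_of_labels_def)

lemma clustering_of_labels_cong:
  "(\<And>i. i < n \<Longrightarrow> f i = g i) \<Longrightarrow> clustering_of_labels n f = clustering_of_labels n g"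
  unfolding clustering_of_labels_def by (intro image_cong refl) auto

lemma sep_clustering_of_labels:
  assumes "i < n" "j < n"
  shows "sep (clustering_of_labels n f) {i, j} = of_bool (f i \<noteq> f j)"
  using assms by (auto simp: sep_def clustering_of_labels_def)

lemma sum_ordered_edges:
  fixes g :: "nat set \<Rightarrow> real"
  assumes E: "E \<subseteq> pairs {..<n}"
  shows "(\<Sum>i<n. \<Sum>j<n. of_bool ({i, j} \<in> E) * g {i, j}) = 2 * (\<Sum>e\<in>E. g e)"
proof -
  let ?h = "\<lambda>(i, j). {i, j :: nat}"
  let ?P = "{p \<in> {..<n} \<times> {..<n}. ?h p \<in> E}"
  have fin: "finite E"
    using finite_subset[OF E finite_pairs[OF finite_lessThan]] .
  have "(\<Sum>i<n. \<Sum>j<n. of_bool ({i, j} \<in> E) * g {i, j}) =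
      (\<Sum>p\<in>{..<n} \<times> {..<n}. of_bool (?h p \<in> E) * g (?h p))"
    by (simp only: sum.cartesian_product split_def)
  also have "\<dots> = (\<Sum>p\<in>{..<n} \<times> {..<n}. if ?h p \<in> E then g (?h p) else 0)"
    by (intro sum.cong refl) simp
  also have "\<dots> = (\<Sum>p\<in>?P. g (?h p))"
    by (rule sum.inter_filter[symmetric]) simp
  also have "\<dots> = (\<Sum>e\<in>E. \<Sum>p\<in>{p \<in> ?P. ?h p = e}. g (?h p))"
  proof (rule sum.group[symmetric])
    show "finite ?P" by simp
    show "?h ` ?P \<subseteq> E" by blast
  qed (rule fin)
  also have "\<dots> = (\<Sum>e\<in>E. 2 * g e)"
  proof (intro sum.cong refl)
    fix e assume e: "e \<in> E"
    then have "e \<in> pairs {..<n}"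
      using E by blast
    then obtain v w where vw: "e = {v, w}" "v < n" "w < n" "v \<noteq> w"
      by (auto simp: pairs_def card_2_iff)
    have "{p \<in> ?P. ?h p = e} = {p \<in> {..<n} \<times> {..<n}. ?h p = e}"
      using e by blast
    also have "\<dots> = {(v, w), (w, v)}"
      using vw by (auto simp: doubleton_eq_iff)
    finally have "card {p \<in> ?P. ?h p = e} = 2"
      using vw(4) by simp
    moreover have "(\<Sum>p\<in>{p \<in> ?P. ?h p = e}. g (?h p)) = (\<Sum>p\<in>{p \<in> ?P. ?h p = e}. g e)"
      by (intro sum.cong refl) (simp only: mem_Collect_eq)
    ultimately show "(\<Sum>p\<in>{p \<in> ?P. ?h p = e}. g (?h p)) = 2 * g e"
      by simp
  qed
  finally show ?thesis by (simp add: sum_distrib_left)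
qed

section \<open>Transfer of approximation guarantees between parameters\<close>

definition approximates :: "nat \<Rightarrow> nat set set \<Rightarrow> real \<Rightarrow> real \<Rightarrow> (nat \<Rightarrow> nat) \<Rightarrow> bool" where
  "approximates n E r l f \<longleftrightarrow>
     (\<forall>C. partition_on {..<n} C \<longrightarrow> LamPrime E (clustering_of_labels n f) l \<le> r * LamPrime E C l)"

lemma approximates_cong:
  "(\<And>i. i < n \<Longrightarrow> f i = g i) \<Longrightarrow> approximates n E r l f = approximates n E r l g"
  using clustering_of_labels_cong[of n f g] by (simp add: approximates_def)

text \<open>For a fixed clustering the cost is affine in \<open>l\<close> with nonnegative
  coefficients. This is why \<open>approximates\<close> quantifies over all competitors instead of
  using the minimum: the transfer works for each competitor separately.\<close>

lemma LamPrime_affine: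
  assumes "simple_graph V E" "partition_on V C"
  shows "LamPrime E C l = (\<Sum>e\<in>E. sep C e) + l * (\<Sum>e\<in>pairs V. 1 - sep C e)"
  using LamPrime_eq_lp_objective[of V E C l] assms
  by (simp add: lp_objective_def simple_graph_def sum_distrib_left)

text \<open>Only the computed clustering loses the factor 2; the cost of a competitor can only grow
  with the parameter.\<close>

lemma approximates_larger:
  assumes G: "simple_graph {..<n} E" and l: "0 < l" "l \<le> l'" "l' \<le> 2 * l" and r: "0 \<le> r"
    and f: "approximates n E r l f"
  shows "approximates n E (2 * r) l' f"
  unfolding approximates_def
proof (intro allI impI)
  fix C assume C: "partition_on {..<n} C"
  let ?C = "clustering_of_labels n f"
  note P = partition_on_clustering_of_labels[of n f]
  have pos: "0 \<le> (\<Sum>e\<in>E. sep C' e)" "0 \<le> (\<Sum>e\<in>pairs {..<n}. 1 - sep C' e)" for C' :: "nat set set"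
    by (auto intro!: sum_nonneg simp: sep_bounds)
  have "LamPrime E ?C l' \<le> 2 * LamPrime E ?C l"
    unfolding LamPrime_affine[OF G P]
    using pos(1)[of ?C] mult_right_mono[OF l(3) pos(2)[of ?C]] by (simp add: algebra_simps)
  also have "\<dots> \<le> 2 * (r * LamPrime E C l)"
    using f C by (simp add: approximates_def)
  also have "\<dots> \<le> 2 * (r * LamPrime E C l')"
  proof -
    have "LamPrime E C l \<le> LamPrime E C l'"
      unfolding LamPrime_affine[OF G C] using mult_right_mono[OF l(2) pos(2)[of C]] by simp
    then show ?thesis using r by (simp add: mult_left_mono)
  qed
  finally show "LamPrime E ?C l' \<le> 2 * r * LamPrime E C l'" by simp
qed

text \<open>For \<open>l\<close> this small, a clustering within factor \<open>r\<close> of the single cluster \<open>V\<close> costs less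
  than 1 and so cannot cut any edge.\<close>

lemma approximates_smaller:
  assumes G: "simple_graph {..<n} E" and l: "0 < l'" "l' \<le> l" and r: "1 \<le> r"
    and small: "r * l * real (n choose 2) < 1" and f: "approximates n E r l f"
  shows "approximates n E r l' f"
  unfolding approximates_def
proof (intro allI impI)
  fix C assume C: "partition_on {..<n} C"
  let ?C = "clustering_of_labels n f"
  let ?X = "\<lambda>C. \<Sum>e\<in>E. sep C e" and ?Q = "\<lambda>C. \<Sum>e\<in>pairs {..<n}. 1 - sep C e"
  note P = partition_on_clustering_of_labels[of n f]
  have pos: "0 \<le> ?X C'" "0 \<le> ?Q C'" for C' :: "nat set set"
    by (auto intro!: sum_nonneg simp: sep_bounds)
  have finE: "finite E"
    using G finite_subset[OF _ finite_pairs[OF finite_lessThan], of E n] by (simp add: simple_graph_def)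
  \<comment> \<open>The number of cut edges is an integer, so a cost below 1 rules out any cut
    edge.\<close>
  have int: "?X C' = 0 \<or> 1 \<le> ?X C'" for C'
  proof -
    have "?X C' = real (card {e \<in> E. \<not> (\<exists>S\<in>C'. e \<subseteq> S)})"
      using finE by (simp add: sep_def sum.If_cases Int_def)
    then obtain N where "?X C' = real N" by blast
    then show ?thesis by (cases N) simp_all
  qed
  have "LamPrime E ?C l < 1"
  proof (cases "n = 0")
    case True
    then show ?thesis by (simp add: clustering_of_labels_def LamPrime_def)
  next
    case False
    then have V: "partition_on {..<n} {{..<n}}"
      by (auto simp: partition_on_def)
    have "sep {{..<n}} e = 0" if "e \<in> pairs {..<n}" for e
      using that by (simp add: sep_def pairs_def)
    moreover have "card (pairs {..<n}) = n choose 2"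
      using n_subsets[of "{..<n}" 2] by (simp add: pairs_def)
    moreover have "(\<Sum>e\<in>E. sep {{..<n}} e) = 0"
      using calculation G by (intro sum.neutral) (auto simp: simple_graph_def)
    ultimately have "LamPrime E {{..<n}} l = l * real (n choose 2)"
      unfolding LamPrime_affine[OF G V] by simp
    moreover have "LamPrime E ?C l \<le> r * LamPrime E {{..<n}} l"
      using f V by (simp add: approximates_def)
    ultimately show ?thesis
      using small by simp
  qed
  then have c1: "?X ?C + l * ?Q ?C < 1"
    by (simp add: LamPrime_affine[OF G P])
  have X0: "?X ?C = 0"
  proof -
    have "0 \<le> l * ?Q ?C"
      using pos(2)[of ?C] l by simp
    then show ?thesis
      using int[of ?C] c1 by linarith
  qed
  show "LamPrime E ?C l' \<le> r * LamPrime E C l'"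
  \<comment> \<open>Against a competitor without cut edges both costs are proportional to the
    parameter, and the ratio carries over. Any other competitor costs at least 1, more than the
    computed clustering.\<close>
  proof (cases "?X C = 0")
    case True
    have "LamPrime E ?C l \<le> r * LamPrime E C l"
      using f C by (simp add: approximates_def)
    then have "?X ?C + l * ?Q ?C \<le> r * (?X C + l * ?Q C)"
      unfolding LamPrime_affine[OF G C] LamPrime_affine[OF G P] .
    then have "l * ?Q ?C \<le> l * (r * ?Q C)"
      using True X0 by (simp add: algebra_simps)
    then have "?Q ?C \<le> r * ?Q C"
      using l by simp
    then have "l' * ?Q ?C \<le> l' * (r * ?Q C)"
      using l by (intro mult_left_mono) auto
    then show ?thesis
      unfolding LamPrime_affine[OF G C] LamPrime_affine[OF G P] True X0 by (simp add: algebra_simps)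
  next
    case False
    then have "1 \<le> ?X C"
      using int[of C] by blast
    moreover have "0 \<le> l' * ?Q C"
      using pos(2)[of C] l by simp
    ultimately have 1: "1 \<le> LamPrime E C l'"
      unfolding LamPrime_affine[OF G C] by linarith
    have a: "LamPrime E ?C l' \<le> 1"
      using c1 mult_right_mono[OF l(2) pos(2)[of ?C]] unfolding LamPrime_affine[OF G P] by linarith
    have "r * 1 \<le> r * LamPrime E C l'"
      by (rule mult_left_mono[OF 1]) (rule order_trans[OF zero_le_one r])
    then have "r \<le> r * LamPrime E C l'"
      by (simp only: mult_1_right)
    then show ?thesis
      by (rule order_trans[OF order_trans[OF a r]])
  qed
qed

lemma approximates_LamPrime_min:
  assumes "approximates n E r l f"
  shows "LamPrime E (clustering_of_labels n f) l \<le> r * LamPrime_min {..<n} E l"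
proof -
  have eq: "{LamPrime E C l | C. partition_on {..<n} C} = (\<lambda>C. LamPrime E C l) ` {C. partition_on {..<n} C}"
    by auto
  have "{C. partition_on {..<n} C} \<subseteq> Pow (Pow {..<n})"
    by (auto simp: partition_on_def)
  then have "finite {C. partition_on {..<n} C}"
    using finite_subset by blast
  then have "LamPrime_min {..<n} E l \<in> (\<lambda>C. LamPrime E C l) ` {C. partition_on {..<n} C}"
    unfolding LamPrime_min_def eq
    by (intro Min_in) (use partition_on_clustering_of_labels[of n f] in auto)
  then show ?thesis
    using assms by (auto simp: approximates_def)
qed

lemma approximates_grid:
  assumes G: "simple_graph {..<n} E" and l: "0 < l" "l < 1" and r: "1 \<le> r" and k: "0 < k"
    and small: "r * real (n choose 2) < 2 ^ k"
    and f: "\<And>q. q < k \<Longrightarrow> approximates n E r (1 / 2 ^ Suc q) (f q)"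
  shows "\<exists>q<k. approximates n E (2 * r) l (f q)"
proof (cases "l \<le> 1 / 2 ^ k")
  case True
  have kk: "Suc (k - 1) = k" "k - 1 < k" using k by simp_all
  have a: "approximates n E r (1 / 2 ^ k) (f (k - 1))"
    using f[OF kk(2)] unfolding kk(1) .
  have "approximates n E r l (f (k - 1))"
    by (rule approximates_smaller[OF G l(1) True r _ a]) (use small in \<open>simp add: field_simps\<close>)
  \<comment> \<open>Here both parameters are \<open>l\<close>; the ratio is weakened to match the
    other case.\<close>
  then have "approximates n E (2 * r) l (f (k - 1))"
    by (rule approximates_larger[OF G l(1), rotated -1]) (use l r in auto)
  then show ?thesis using kk by blast
next
  case False
  \<comment> \<open>The largest grid point strictly below \<open>l\<close>. Its predecessor on the
    grid is at least \<open>l\<close>, which gives the factor 2; for \<open>q = 0\<close> the bound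
    \<open>l < 1\<close> takes its place, since the grid starts at \<open>1 / 2\<close>.\<close>
  define q where "q = (LEAST q. 1 / 2 ^ Suc q < l)"
  have ex: "1 / 2 ^ Suc (k - 1) < l" using False k by simp
  have q: "1 / 2 ^ Suc q < l" "q \<le> k - 1"
    unfolding q_def using LeastI[of "\<lambda>q. 1 / 2 ^ Suc q < l", OF ex] Least_le[of "\<lambda>q. 1 / 2 ^ Suc q < l", OF ex] by auto
  have "l \<le> 2 * (1 / 2 ^ Suc q)"
  proof (cases q)
    case 0
    then show ?thesis using l by simp
  next
    case (Suc q')
    then have "\<not> 1 / 2 ^ Suc q' < l"
      using not_less_Least[of q' "\<lambda>q. 1 / 2 ^ Suc q < l"] by (simp add: q_def)
    then show ?thesis by (simp add: Suc)
  qed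
  then have "approximates n E (2 * r) l (f q)"
    by (intro approximates_larger[OF G _ _ _ _ f]) (use q k r in auto)
  then show ?thesis using q k by (intro exI[of _ q]) auto
qed

text \<open>The solver is only accountable for the cells above the diagonal; the others may contain
  anything. This completes them to a symmetric matrix with zero diagonal.\<close>

definition pair_dist :: "(nat \<Rightarrow> nat \<Rightarrow> real) \<Rightarrow> nat \<Rightarrow> nat \<Rightarrow> real" where
  "pair_dist x i j = (if i < j then x i j else if j < i then x j i else 0)"

lemma pair_dist_lp_output: "i \<noteq> j \<Longrightarrow> pair_dist (rmem s ''x'') i j = lp_output s {i, j}"
  by (auto simp: pair_dist_def lp_output_def min_def max_def)

text \<open>The \<open>n\<close> seeds \<open>l / n\<close> add up to the single additive
  \<open>l\<close> that \<open>LamPrime_le_lp_objective\<close> tolerates. Passing from ordered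
  pairs to edges doubles both sides of the cut bound, so these factors cancel.\<close>

lemma approximates_ball_growing:
  fixes n E s k
  defines "a \<equiv> \<lambda>i j. of_bool ({i, j} \<in> E)" and "D \<equiv> pair_dist (rmem s ''x'')"
  assumes G: "simple_graph {..<n} E" and l: "0 < l" "l \<le> 1" and n: "0 < n"
    and opt: "lp_optimal {..<n} E l (lp_output s)"
    and \<alpha>: "0 < \<alpha>" and growth: "l / n + real n ^ 2 \<le> l / n * exp (\<alpha> / 4)"
  shows ball_growing_pair_dist: "ball_growing n a D \<alpha> (l / n)"
    and "ball_growing.ball_inv n a D \<alpha> (l / n) n f c u k v \<Longrightarrow> approximates n E (2 * \<alpha> + 2) l f"
proof -
  have E: "E \<subseteq> pairs {..<n}"
    using G by (simp add: simple_graph_def)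
  have feas: "lp_feasible {..<n} (lp_output s)"
    using opt by (simp add: lp_optimal_def)
  have D: "D i j = lp_output s {i, j}" if "i \<noteq> j" for i j
    unfolding D_def by (rule pair_dist_lp_output[OF that])
  have Dii: "D i i = 0" for i
    by (simp add: D_def pair_dist_def)
  have D01: "0 \<le> D i j" "D i j \<le> 1" if "i < n" "j < n" for i j
  proof -
    have "{i, j} \<in> pairs {..<n}" if "i \<noteq> j"
      using that \<open>i < n\<close> \<open>j < n\<close> by (auto simp: pairs_def)
    then have "i \<noteq> j \<Longrightarrow> 0 \<le> D i j \<and> D i j \<le> 1"
      using feas D unfolding lp_feasible_def by simp
    then show "0 \<le> D i j" "D i j \<le> 1"
      using Dii by (cases "i = j"; simp)+
  qed
  have Dsym: "D i j = D j i" for i j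
    by (simp add: D_def pair_dist_def)
  show bg: "ball_growing n a D \<alpha> (l / n)"
  proof
    show "D i j \<le> D i k + D k j" if "i < n" "j < n" "k < n" for i j k
    proof (cases "i \<noteq> j \<and> j \<noteq> k \<and> i \<noteq> k")
      case True
      then have "lp_output s {i, j} \<le> lp_output s {i, k} + lp_output s {j, k}"
        using feas that unfolding lp_feasible_def by blast
      then show ?thesis using True D Dsym[of k j] by simp
    next
      case False
      \<comment> \<open>The LP has no constraints for degenerate triangles; these hold by the zero
        diagonal and nonnegativity.\<close>
      then consider "i = j" | "j = k" | "i = k"
        by blast
      then show ?thesis
        using D01[OF that(1,3)] D01[OF that(3,2)] Dii by cases simp_all
    qed
    show "a i i = 0" for i
      using E by (auto simp: a_def pairs_def)
  qed (use D01 Dii Dsym \<alpha> growth l n in \<open>auto simp: a_def insert_commute\<close>)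
  assume "ball_growing.ball_inv n a D \<alpha> (l / n) n f c u k v"
  note fin = ball_growing.ball_inv_final[OF bg this]
  let ?C = "clustering_of_labels n f"
  have "2 * (\<Sum>e\<in>E. sep ?C e) = (\<Sum>i<n. \<Sum>j<n. a i j * of_bool (f i \<noteq> f j))"
    unfolding sum_ordered_edges[OF E, symmetric] a_def
    by (intro sum.cong refl) (simp add: sep_clustering_of_labels)
  also have "\<dots> \<le> \<alpha> * (2 * real n * (l / n) + (\<Sum>i<n. \<Sum>j<n. a i j * D i j))"
    by (rule fin(1))
  also have "(\<Sum>i<n. \<Sum>j<n. a i j * D i j) = 2 * (\<Sum>e\<in>E. lp_output s e)"
    unfolding sum_ordered_edges[OF E, symmetric] a_def
  proof (intro sum.cong refl)
    fix i j
    show "of_bool ({i, j} \<in> E) * D i j = of_bool ({i, j} \<in> E) * lp_output s {i, j}"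
      using E D[of i j] by (cases "i = j") (auto simp: pairs_def)
  qed
  finally have cut: "(\<Sum>e\<in>E. sep ?C e) \<le> \<alpha> * (l + (\<Sum>e\<in>E. lp_output s e))"
    using n by (simp add: algebra_simps)
  have near: "lp_output s e \<le> 1 / 2" if ep: "e \<in> pairs {..<n}" "sep ?C e = 0" for e
  proof -
    obtain i j where e: "e = {i, j}" "i < n" "j < n" "i \<noteq> j"
      using ep(1) by (auto simp: pairs_def card_2_iff)
    then show ?thesis
      using fin(2)[of i j] ep(2) by (simp add: D sep_clustering_of_labels)
  qed
  show "approximates n E (2 * \<alpha> + 2) l f"
    unfolding approximates_def
  proof (intro allI impI)
    fix C assume C: "partition_on {..<n} C"
    have "LamPrime E ?C l \<le> (2 * \<alpha> + 2) * lp_objective {..<n} E l (lp_output s)"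
      using \<alpha> by (intro LamPrime_le_lp_objective[OF G l feas partition_on_clustering_of_labels _ cut near]) auto
    also have "\<dots> \<le> (2 * \<alpha> + 2) * LamPrime E C l"
      using lp_optimal_le_LamPrime[OF G opt C] \<alpha> by (intro mult_left_mono) auto
    finally show "LamPrime E ?C l \<le> (2 * \<alpha> + 2) * LamPrime E C l" .
  qed
qed

section \<open>The rounding program\<close>

text \<open>Array \<open>f\<close> holds the labels of the current rounding (\<open>0\<close> for unassigned vertices); the ball
  that is being grown has label \<open>cid\<close> and centre \<open>u\<close>, and \<open>m\<close> counts the labelled vertices.\<close>

definition symmetrise :: com where
  "symmetrise = For ''i'' ''n'' (For ''j'' ''n''
     (Cond (NLess (nvar ''i'') (nvar ''j''))
       (RSet ''D'' (nvar ''i'') (nvar ''j'') (RGet ''x'' (nvar ''i'') (nvar ''j'')))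
       (Cond (NLess (nvar ''j'') (nvar ''i''))
         (RSet ''D'' (nvar ''i'') (nvar ''j'') (RGet ''x'' (nvar ''j'') (nvar ''i'')))
         (RSet ''D'' (nvar ''i'') (nvar ''j'') (ROfNat (NConst 0))))))"

definition clear_labels :: com where
  "clear_labels = For ''i'' ''n'' (NSet ''f'' (NConst 0) (nvar ''i'') (NConst 0))"

definition copy_labels :: com where
  "copy_labels = For ''i'' ''n'' (NSet ''c'' (nvar ''q'') (nvar ''i'') (NGet ''f'' (NConst 0) (nvar ''i'')))"

text \<open>The vertex found serves twice: as the centre if a new ball is started, and as the first
  candidate in the search of \<open>closest\<close>.\<close>

definition pick :: com where
  "pick = For ''j'' ''n'' (Cond (NLess (NGet ''f'' (NConst 0) (nvar ''j'')) (NConst 1))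
     (nset ''w'' (nvar ''j'')) Skip)"

text \<open>The initial empty ball has cut 0 and passes the closing test, so the first real centre
  is chosen here too and the one set by \<open>start_ball\<close> is a placeholder. The label
  \<open>m + 1\<close> is the fresh one of \<open>ball_inv_close\<close>.\<close>

definition reseed :: com where
  "reseed = Cond (BNot (RLess (RMul (RMul (ROfNat (NConst 8)) (ROfNat (nvar ''k''))) (rvar ''vol'')) (rvar ''cut'')))
     (Seq (nset ''u'' (nvar ''w'')) (Seq (nset ''cid'' (NAdd (nvar ''m'') (NConst 1)))
       (Seq (rset ''cut'' (ROfNat (NConst 0))) (rset ''vol'' (RDiv (rvar ''l'') (ROfNat (nvar ''n'')))))))
     Skip"

definition closest :: com where
  "closest = For ''j'' ''n'' (Cond (BAnd (NLess (NGet ''f'' (NConst 0) (nvar ''j'')) (NConst 1))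
       (RLess (RGet ''D'' (nvar ''u'') (nvar ''j'')) (RGet ''D'' (nvar ''u'') (nvar ''w''))))
     (nset ''w'' (nvar ''j'')) Skip)"

text \<open>\<open>w\<close> already carries the label \<open>cid\<close> at this point, but
  contributes nothing to its own update because the diagonal of \<open>adj\<close> is 0. Equality of
  labels is expressed by two negated comparisons.\<close>

definition update :: com where
  "update = For ''j'' ''n'' (Cond (NLess (NConst 0) (NGet ''adj'' (nvar ''w'') (nvar ''j'')))
     (Cond (NLess (NGet ''f'' (NConst 0) (nvar ''j'')) (NConst 1))
       (Seq (rset ''cut'' (RAdd (rvar ''cut'') (ROfNat (NConst 1))))
         (rset ''vol'' (RAdd (rvar ''vol'') (RGet ''D'' (nvar ''w'') (nvar ''j'')))))
       (Cond (BAnd (BNot (NLess (NGet ''f'' (NConst 0) (nvar ''j'')) (nvar ''cid'')))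
           (BNot (NLess (nvar ''cid'') (NGet ''f'' (NConst 0) (nvar ''j'')))))
         (rset ''cut'' (RSub (rvar ''cut'') (ROfNat (NConst 1)))) Skip)) Skip)"

definition grow_step :: com where
  "grow_step = Seq pick (Seq reseed (Seq closest
     (Seq (NSet ''f'' (NConst 0) (nvar ''w'') (nvar ''cid'')) update)))"

definition start_ball :: com where
  "start_ball = Seq (nset ''cid'' (NConst 1)) (Seq (nset ''u'' (NConst 0))
     (Seq (rset ''cut'' (ROfNat (NConst 0))) (rset ''vol'' (RDiv (rvar ''l'') (ROfNat (nvar ''n''))))))"

definition rounding :: com where
  "rounding = Seq symmetrise (Seq clear_labels (Seq start_ball (Seq (For ''m'' ''n'' grow_step) copy_labels)))"

lemma writes [simp]:
  "nwrites symmetrise = {''i'', ''j''}" "rwrites symmetrise = {''D''}"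
  "nwrites clear_labels = {''i'', ''f''}" "rwrites clear_labels = {}"
  "nwrites copy_labels = {''i'', ''c''}" "rwrites copy_labels = {}"
  "nwrites pick = {''j'', ''w''}" "rwrites pick = {}"
  "nwrites reseed = {''u'', ''cid''}" "rwrites reseed = {''cut'', ''vol''}"
  "nwrites closest = {''j'', ''w''}" "rwrites closest = {}"
  "nwrites update = {''j''}" "rwrites update = {''cut'', ''vol''}"
  "nwrites grow_step = {''j'', ''w'', ''u'', ''cid'', ''f''}" "rwrites grow_step = {''cut'', ''vol''}"
  "nwrites start_ball = {''cid'', ''u''}" "rwrites start_ball = {''cut'', ''vol''}"
  by (auto simp: symmetrise_def clear_labels_def copy_labels_def pick_def reseed_def closest_def
      update_def grow_step_def start_ball_def)

lemma writes_rounding [simp]: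
  "nwrites rounding = {''i'', ''j'', ''w'', ''u'', ''cid'', ''m'', ''f'', ''c''}"
  "rwrites rounding = {''D'', ''cut'', ''vol''}"
  by (auto simp: rounding_def)

lemma runs_symmetrise:
  assumes n: "nmem s ''n'' 0 0 = n"
  shows "runs P symmetrise s (n * (n * 70 + 30) + 13)
    (\<lambda>s'. \<forall>i<n. \<forall>j<n. rmem s' ''D'' i j = pair_dist (rmem s ''x'') i j)"
  unfolding symmetrise_def
proof (rule runs_For[where B = "n * 70 + 13"
      and I = "\<lambda>k s'. \<forall>i<k. \<forall>j<n. rmem s' ''D'' i j = pair_dist (rmem s ''x'') i j"], goal_cases)
  case (7 k s')
  show ?case
  proof (rule runs_mono, rule runs_For[where B = 53 and m = n
        and I = "\<lambda>k' s''. (\<forall>i<k. \<forall>j<n. rmem s'' ''D'' i j = pair_dist (rmem s ''x'') i j) \<and>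
          (\<forall>j<k'. rmem s'' ''D'' k j = pair_dist (rmem s ''x'') k j)"], goal_cases)
    case (7 k' s'')
    have "nmem s'' ''i'' 0 0 = k" "rmem s'' ''x'' = rmem s ''x''"
      using 7(4) \<open>nmem s' ''i'' 0 0 = k\<close> \<open>frame _ _ s s'\<close> by (simp_all add: frame_def)
    then show ?case
      using 7(2,3) by (intro runs_loop_free) (auto simp: upd_apply pair_dist_def less_Suc_eq)
  qed (use 7 n in \<open>auto simp: frame_def less_Suc_eq\<close>)
qed (use n in \<open>auto simp: algebra_simps\<close>)

lemma runs_clear_labels:
  assumes n: "nmem s ''n'' 0 0 = n"
  shows "runs P clear_labels s (n * 23 + 13) (\<lambda>s'. \<forall>i<n. nmem s' ''f'' 0 i = 0)"
  unfolding clear_labels_def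
proof (rule runs_For[where B = 6 and I = "\<lambda>k s'. \<forall>i<k. nmem s' ''f'' 0 i = 0"], goal_cases)
  case (7 k s')
  then show ?case
    by (intro runs_loop_free) (auto simp: upd_apply less_Suc_eq)
qed (use n in \<open>auto simp: upd_apply\<close>)

lemma runs_copy_labels:
  assumes n: "nmem s ''n'' 0 0 = n" and q: "nmem s ''q'' 0 0 = q"
  shows "runs P copy_labels s (n * 29 + 13)
    (\<lambda>s'. (\<forall>i<n. nmem s' ''c'' q i = nmem s ''f'' 0 i) \<and> (\<forall>q'. q' \<noteq> q \<longrightarrow> nmem s' ''c'' q' = nmem s ''c'' q'))"
  unfolding copy_labels_def
proof (rule runs_For[where B = 12 and I = "\<lambda>k s'. (\<forall>i<k. nmem s' ''c'' q i = nmem s ''f'' 0 i) \<and>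
      (\<forall>q'. q' \<noteq> q \<longrightarrow> nmem s' ''c'' q' = nmem s ''c'' q')"], goal_cases)
  case (7 k s')
  have "nmem s' ''q'' 0 0 = q" "nmem s' ''f'' = nmem s ''f''"
    using 7(4) q by (simp_all add: frame_def)
  then show ?case
    using 7(2,3) by (intro runs_loop_free) (auto simp: upd_def less_Suc_eq)
qed (use n in \<open>auto simp: upd_def\<close>)

lemma runs_pick:
  assumes n: "nmem s ''n'' 0 0 = n" and ex: "\<exists>j<n. nmem s ''f'' 0 j = 0"
  shows "runs P pick s (n * 32 + 13) (\<lambda>s'. nmem s' ''w'' 0 0 < n \<and> nmem s ''f'' 0 (nmem s' ''w'' 0 0) = 0)"
proof -
  have "runs P pick s (n * 32 + 13) (\<lambda>s'. (\<exists>j<n. nmem s ''f'' 0 j = 0) \<longrightarrow>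
      nmem s' ''w'' 0 0 < n \<and> nmem s ''f'' 0 (nmem s' ''w'' 0 0) = 0)"
    unfolding pick_def
  proof (rule runs_For[where B = 15 and I = "\<lambda>k s'. (\<exists>j<k. nmem s ''f'' 0 j = 0) \<longrightarrow>
      nmem s' ''w'' 0 0 < n \<and> nmem s ''f'' 0 (nmem s' ''w'' 0 0) = 0"], goal_cases)
    case (7 k s')
    have "nmem s' ''f'' = nmem s ''f''"
      using 7(4) by (simp add: frame_def)
    then show ?case
      using 7(1,2,3) by (intro runs_loop_free) (auto simp: upd_apply less_Suc_eq)
  qed (use n in \<open>auto simp: upd_apply\<close>)
  then show ?thesis
    by (rule runs_mono) (use ex in auto)
qed

lemma runs_closest:
  assumes n: "nmem s ''n'' 0 0 = n" and w: "nmem s ''w'' 0 0 < n" "nmem s ''f'' 0 (nmem s ''w'' 0 0) = 0"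
  shows "runs P closest s (n * 60 + 13) (\<lambda>s'. nmem s' ''w'' 0 0 < n \<and> nmem s ''f'' 0 (nmem s' ''w'' 0 0) = 0 \<and>
    (\<forall>j<n. nmem s ''f'' 0 j = 0 \<longrightarrow>
      rmem s ''D'' (nmem s ''u'' 0 0) (nmem s' ''w'' 0 0) \<le> rmem s ''D'' (nmem s ''u'' 0 0) j))"
  unfolding closest_def
proof (rule runs_For[where B = 43 and I = "\<lambda>k s'. nmem s' ''w'' 0 0 < n \<and> nmem s ''f'' 0 (nmem s' ''w'' 0 0) = 0 \<and>
    (\<forall>j<k. nmem s ''f'' 0 j = 0 \<longrightarrow>
      rmem s ''D'' (nmem s ''u'' 0 0) (nmem s' ''w'' 0 0) \<le> rmem s ''D'' (nmem s ''u'' 0 0) j)"], goal_cases)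
  case (7 k s')
  have "nmem s' ''f'' = nmem s ''f''" "nmem s' ''u'' = nmem s ''u''" "rmem s' ''D'' = rmem s ''D''"
    using 7(4) by (simp_all add: frame_def)
  then show ?case
    using 7(1,2,3) by (intro runs_loop_free) (auto simp: upd_apply less_Suc_eq)
qed (use n w in \<open>auto simp: upd_apply\<close>)

lemma runs_update:
  assumes n: "nmem s ''n'' 0 0 = n"
  defines "f \<equiv> nmem s ''f'' 0" and "w \<equiv> nmem s ''w'' 0 0" and "c \<equiv> nmem s ''cid'' 0 0"
  defines "a \<equiv> \<lambda>j. of_bool (0 < nmem s ''adj'' w j)"
  shows "runs P update s (n * 120 + 13) (\<lambda>s'.
    rmem s' ''cut'' 0 0 = rmem s ''cut'' 0 0 + (\<Sum>j<n. if f j = 0 then a j else if f j = c then - a j else 0) \<and>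
    rmem s' ''vol'' 0 0 = rmem s ''vol'' 0 0 + (\<Sum>j<n. if f j = 0 then a j * rmem s ''D'' w j else 0))"
  unfolding update_def
proof (rule runs_For[where B = 103 and I = "\<lambda>k s'.
    rmem s' ''cut'' 0 0 = rmem s ''cut'' 0 0 + (\<Sum>j<k. if f j = 0 then a j else if f j = c then - a j else 0) \<and>
    rmem s' ''vol'' 0 0 = rmem s ''vol'' 0 0 + (\<Sum>j<k. if f j = 0 then a j * rmem s ''D'' w j else 0)"], goal_cases)
  case (7 k s')
  have "nmem s' ''f'' = nmem s ''f''" "nmem s' ''w'' = nmem s ''w''" "nmem s' ''cid'' = nmem s ''cid''"
    "nmem s' ''adj'' = nmem s ''adj''" "rmem s' ''D'' = rmem s ''D''"
    using 7(4) by (simp_all add: frame_def)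
  then show ?case
    using 7(2,3) by (intro runs_loop_free) (auto simp: upd_apply a_def f_def w_def c_def)
qed (use n in \<open>auto simp: upd_apply\<close>)

text \<open>The linear coefficient of the time bound is \<open>32 + 60 + 120\<close>, from
  \<open>pick\<close>, \<open>closest\<close> and \<open>update\<close>.\<close>

lemma runs_grow_step:
  fixes s :: state and n E l
  defines "a \<equiv> \<lambda>i j. of_bool ({i, j} \<in> E) :: real" and "\<alpha> \<equiv> 8 * real (nmem s ''k'' 0 0)"
    and "\<delta> \<equiv> rmem s ''l'' 0 0 / real n"
  assumes bg: "ball_growing n a D \<alpha> \<delta>" and G: "holds_graph s n E"
    and DD: "\<forall>i<n. \<forall>j<n. rmem s ''D'' i j = D i j"
    and m: "nmem s ''m'' 0 0 = m" "m < n"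
    and inv: "ball_growing.ball_inv n a D \<alpha> \<delta> m (nmem s ''f'' 0) (nmem s ''cid'' 0 0) (nmem s ''u'' 0 0)
      (rmem s ''cut'' 0 0) (rmem s ''vol'' 0 0)"
  shows "runs P grow_step s (n * 212 + 200) (\<lambda>s'.
    ball_growing.ball_inv n a D \<alpha> \<delta> (Suc m) (nmem s' ''f'' 0) (nmem s' ''cid'' 0 0) (nmem s' ''u'' 0 0)
      (rmem s' ''cut'' 0 0) (rmem s' ''vol'' 0 0))"
proof -
  interpret ball_growing n a D \<alpha> \<delta> by (rule bg)
  have n: "nmem s ''n'' 0 0 = n" and adj: "\<And>i j. i < n \<Longrightarrow> j < n \<Longrightarrow> (0 < nmem s ''adj'' i j) = ({i, j} \<in> E)"
    using G by (auto simp: holds_graph_def)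
  define f where "f = nmem s ''f'' 0"
  have inv: "ball_inv m f (nmem s ''cid'' 0 0) (nmem s ''u'' 0 0) (rmem s ''cut'' 0 0) (rmem s ''vol'' 0 0)"
    using inv by (simp only: f_def)
  have fm: "f i \<le> m" if "i < n" for i
    using inv that by (simp add: ball_inv_def)
  have ex: "\<exists>j<n. f j = 0"
  proof (rule ccontr)
    assume "\<not> (\<exists>j<n. f j = 0)"
    then have "unassigned f = {}" by (auto simp: unassigned_def)
    then show False using inv m(2) by (simp add: ball_inv_def)
  qed
  \<comment> \<open>After \<open>reseed\<close>, either the old ball failed the closing test or a
    fresh ball has just been started: exactly the alternatives under which
    \<open>ball_inv_add\<close> applies.\<close>
  define S where "S = (\<lambda>s' :: state. ball_inv m f (nmem s' ''cid'' 0 0) (nmem s' ''u'' 0 0) (rmem s' ''cut'' 0 0) (rmem s' ''vol'' 0 0) \<and>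
    (\<alpha> * rmem s' ''vol'' 0 0 < rmem s' ''cut'' 0 0 \<or>
      (members f (nmem s' ''cid'' 0 0) = {} \<and> nmem s' ''u'' 0 0 \<in> unassigned f \<and> nmem s' ''cid'' 0 0 \<le> Suc m)))"
  show ?thesis
    unfolding grow_step_def
  proof (rule runs_Seq[where B' = "n * 180 + 186", OF runs_pick[OF n]], goal_cases)
    case 1
    show ?case using ex by (simp add: f_def)
  next
    case (2 s1)
    then have s1: "nmem s1 ''w'' 0 0 < n" "f (nmem s1 ''w'' 0 0) = 0" and fr1: "frame {''j'', ''w''} {} s s1"
      by (simp_all add: f_def)
    show ?case
    proof (rule runs_Seq[where B = 66 and Q = S and B' = "n * 180 + 119"], goal_cases)
      case 1
      show ?case
      proof (rule runs_loop_free)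
        let ?w = "nmem s1 ''w'' 0 0"
        have eqs: "nmem s1 ''k'' = nmem s ''k''" "nmem s1 ''m'' = nmem s ''m''" "nmem s1 ''n'' = nmem s ''n''"
          "nmem s1 ''cid'' = nmem s ''cid''" "nmem s1 ''u'' = nmem s ''u''" "rmem s1 = rmem s"
          using fr1 by (simp_all add: frame_def fun_eq_iff)
        have cl: "ball_inv m f (Suc m) ?w 0 \<delta>" if "rmem s ''cut'' 0 0 \<le> \<alpha> * rmem s ''vol'' 0 0"
          by (rule ball_inv_close[OF inv that s1(1)])
        have mem: "members f (Suc m) = {}" "?w \<in> unassigned f"
          using fm s1 by (fastforce simp: members_def unassigned_def)+
        show "S (den reseed s1)"
          unfolding S_def reseed_def using cl mem inv m(1) n
          by (auto simp: eqs upd_apply \<alpha>_def[symmetric] \<delta>_def[symmetric] not_less)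
      qed (simp_all add: reseed_def)
    next
      case (2 s2)
      have w2: "nmem s2 ''w'' = nmem s1 ''w''" and f2: "nmem s2 ''f'' 0 = f"
        and eq2: "nmem s2 ''n'' = nmem s ''n''" "nmem s2 ''adj'' = nmem s ''adj''" "rmem s2 ''D'' = rmem s ''D''"
        using 2(2) fr1 by (simp_all add: frame_def f_def)
      show ?case
      proof (rule runs_Seq[where B' = "n * 120 + 105", OF runs_closest[where n = n]], goal_cases)
        case (4 s3)
        define w c u where "w = nmem s3 ''w'' 0 0" and "c = nmem s2 ''cid'' 0 0" and "u = nmem s2 ''u'' 0 0"
        have eq3: "nmem s3 ''n'' = nmem s ''n''" "nmem s3 ''adj'' = nmem s ''adj''" "nmem s3 ''f'' 0 = f"
          "nmem s3 ''cid'' 0 0 = c" "nmem s3 ''u'' 0 0 = u" "rmem s3 = rmem s2"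
          using 4(2) eq2 f2 by (simp_all add: frame_def c_def u_def fun_eq_iff)
        have u: "u < n"
          using 2(1) m(2) unfolding S_def u_def by (simp add: ball_inv_def)
        have w: "w < n" "w \<in> unassigned f" and near: "\<And>j. j \<in> unassigned f \<Longrightarrow> D u w \<le> D u j"
          using 4(1) f2 eq2 DD u by (auto simp: w_def u_def unassigned_def)
        have c: "0 < c"
          using 2(1) unfolding S_def c_def by (simp add: ball_inv_def)
        let ?f = "f(w := c)"
        have step: "ball_inv (Suc m) ?f c u
            (rmem s2 ''cut'' 0 0 + (\<Sum>j\<in>unassigned ?f. a w j) - (\<Sum>j\<in>members ?f c. a w j))
            (rmem s2 ''vol'' 0 0 + (\<Sum>j\<in>unassigned ?f. a w j * D w j))"
          by (rule ball_inv_add[of m f c u]) (use 2(1) w near in \<open>simp_all add: S_def c_def u_def\<close>)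
        show ?case
        proof (rule runs_Seq[where B = 9 and B' = "n * 120 + 95"
              and Q = "\<lambda>s4. s4 = s3\<lparr>nmem := upd (nmem s3) ''f'' 0 w c\<rparr>"], goal_cases)
          case 1
          show ?case by (rule runs_loop_free) (simp_all add: w_def eq3)
        next
          case (2 s4)
          have eq4: "nmem s4 ''f'' 0 = ?f" "nmem s4 ''n'' = nmem s ''n''" "nmem s4 ''adj'' = nmem s ''adj''"
            "nmem s4 ''w'' 0 0 = w" "nmem s4 ''cid'' 0 0 = c" "nmem s4 ''u'' 0 0 = u" "rmem s4 = rmem s2"
            "rmem s4 ''D'' = rmem s ''D''"
            using 2(1) eq3 eq2 by (simp_all add: upd_def w_def)
          show ?case
          proof (rule runs_mono[OF runs_update[where n = n]], goal_cases)
            case (3 s5)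
            have eq5: "nmem s5 ''f'' 0 = ?f" "nmem s5 ''cid'' 0 0 = c" "nmem s5 ''u'' 0 0 = u"
              using 3(2) eq4 by (simp_all add: frame_def)
            have split: "(\<Sum>j<n. if ?f j = 0 then g j else if ?f j = c then h j else 0) =
                (\<Sum>j\<in>unassigned ?f. g j) + (\<Sum>j\<in>members ?f c. h j)" for g h :: "nat \<Rightarrow> real"
            proof -
              have "(\<Sum>j<n. if ?f j = 0 then g j else if ?f j = c then h j else 0) =
                  (\<Sum>j<n. (if ?f j = 0 then g j else 0) + (if ?f j = c then h j else 0))"
                using c by (intro sum.cong) auto
              moreover have "(\<Sum>j<n. if ?f j = 0 then g j else 0) = (\<Sum>j\<in>unassigned ?f. g j)"
                unfolding sum.inter_filter[OF finite_lessThan, symmetric]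
                by (rule sum.cong) (auto simp: unassigned_def)
              moreover have "(\<Sum>j<n. if ?f j = c then h j else 0) = (\<Sum>j\<in>members ?f c. h j)"
                unfolding sum.inter_filter[OF finite_lessThan, symmetric]
                by (rule sum.cong) (auto simp: members_def)
              ultimately show ?thesis by (simp only: sum.distrib)
            qed
            have "rmem s5 ''cut'' 0 0 = rmem s2 ''cut'' 0 0 +
                (\<Sum>j<n. if ?f j = 0 then a w j else if ?f j = c then - a w j else 0)"
              using conjunct1[OF 3(1)] unfolding eq4 a_def using adj[OF w(1)]
              by (simp cong: if_cong sum.cong_simp)
            also have "\<dots> = rmem s2 ''cut'' 0 0 + (\<Sum>j\<in>unassigned ?f. a w j) - (\<Sum>j\<in>members ?f c. a w j)"
              unfolding split by (simp add: sum_negf)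
            finally have cut: "rmem s5 ''cut'' 0 0 = \<dots>" .
            have "rmem s5 ''vol'' 0 0 = rmem s2 ''vol'' 0 0 +
                (\<Sum>j<n. if ?f j = 0 then a w j * D w j else if ?f j = c then 0 else 0)"
              using conjunct2[OF 3(1)] unfolding eq4 a_def using adj[OF w(1)] DD w(1)
              by (simp add: eq2 cong: if_cong sum.cong_simp)
            also have "\<dots> = rmem s2 ''vol'' 0 0 + (\<Sum>j\<in>unassigned ?f. a w j * D w j)"
              unfolding split by simp
            finally have vol: "rmem s5 ''vol'' 0 0 = \<dots>" .
            show ?case
              unfolding eq5 cut vol by (rule step)
          qed (use n eq4 in simp_all)
        next
          case 3
          show ?case by (simp add: algebra_simps)
        qed
      next
        case 5
        show ?case by (simp add: algebra_simps)
      qed (use n eq2 w2 f2 s1 in simp_all)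
    next
      case 3
      show ?case by (simp add: algebra_simps)
    qed
  next
    case 3
    show ?case by simp
  qed
qed

lemma runs_rounding:
  fixes s :: state and n E
  defines "k \<equiv> nmem s ''k'' 0 0" and "l \<equiv> rmem s ''l'' 0 0" and "q \<equiv> nmem s ''q'' 0 0"
  assumes G: "simple_graph {..<n} E" "holds_graph s n E" and l: "0 < l" "l \<le> 1" and k: "0 < k"
    and opt: "lp_optimal {..<n} E l (lp_output s)"
    and growth: "0 < n \<Longrightarrow> l / n + real n ^ 2 \<le> l / n * exp (2 * real k)"
  shows "runs P rounding s (n * (n * 282 + 299) + 100) (\<lambda>s'.
    approximates n E (16 * real k + 2) l (nmem s' ''c'' q) \<and> (\<forall>q'. q' \<noteq> q \<longrightarrow> nmem s' ''c'' q' = nmem s ''c'' q'))"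
proof -
  let ?a = "\<lambda>i j. of_bool ({i, j} \<in> E) :: real" and ?D = "pair_dist (rmem s ''x'')"
    and ?\<alpha> = "8 * real k" and ?\<delta> = "l / real n"
  have n: "nmem s ''n'' 0 0 = n"
    using G by (simp add: holds_graph_def)
  have \<alpha>: "0 < ?\<alpha>"
    using k by simp
  have gr: "0 < n \<Longrightarrow> l / n + real n ^ 2 \<le> l / n * exp (?\<alpha> / 4)"
    using growth by simp
  let ?inv = "ball_growing.ball_inv n ?a ?D ?\<alpha> ?\<delta>"
  have bg: "ball_growing n ?a ?D ?\<alpha> ?\<delta>" if "0 < n"
    by (rule ball_growing_pair_dist[OF G(1) l that opt \<alpha> gr[OF that]])
  \<comment> \<open>The seed \<open>l / n\<close> is positive only for nonempty graphs, hence the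
    guard. For \<open>n = 0\<close> the clustering is empty and costs nothing.\<close>
  let ?I = "\<lambda>m s'. 0 < n \<longrightarrow> ?inv m (nmem s' ''f'' 0) (nmem s' ''cid'' 0 0) (nmem s' ''u'' 0 0)
      (rmem s' ''cut'' 0 0) (rmem s' ''vol'' 0 0)"
  show ?thesis
    unfolding rounding_def
  proof (rule runs_Seq[where B' = "n * (n * 212 + 269) + 86", OF runs_symmetrise[OF n]], goal_cases)
    case (1 s1)
    have eq1: "nmem s1 ''n'' = nmem s ''n''" "nmem s1 ''k'' = nmem s ''k''" "nmem s1 ''q'' = nmem s ''q''"
      "nmem s1 ''adj'' = nmem s ''adj''" "nmem s1 ''c'' = nmem s ''c''" "rmem s1 ''l'' = rmem s ''l''"
      using 1(2) by (simp_all add: frame_def)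
    show ?case
    proof (rule runs_Seq[where B' = "n * (n * 212 + 246) + 72", OF runs_clear_labels[where n = n]], goal_cases)
      case (2 s2)
      have eq2: "nmem s2 ''n'' = nmem s ''n''" "nmem s2 ''k'' = nmem s ''k''" "nmem s2 ''q'' = nmem s ''q''"
        "nmem s2 ''adj'' = nmem s ''adj''" "nmem s2 ''c'' = nmem s ''c''" "rmem s2 ''l'' = rmem s ''l''"
        "rmem s2 ''D'' = rmem s1 ''D''"
        using 2(2) eq1 by (simp_all add: frame_def)
      show ?case
      proof (rule runs_Seq[where B' = "n * (n * 212 + 246) + 41", OF runs_loop_free[of start_ball 30 "?I 0"]], goal_cases)
        case 3
        show ?case
        proof
          assume "0 < n"
          have "?inv 0 (nmem s2 ''f'' 0) 1 0 0 ?\<delta>"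
            by (rule ball_growing.ball_inv_initial[OF bg[OF \<open>0 < n\<close>]]) (use 2(1) in simp)
          then show "?inv 0 (nmem (den start_ball s2) ''f'' 0) (nmem (den start_ball s2) ''cid'' 0 0)
              (nmem (den start_ball s2) ''u'' 0 0) (rmem (den start_ball s2) ''cut'' 0 0) (rmem (den start_ball s2) ''vol'' 0 0)"
            using n by (simp add: start_ball_def upd_apply upd_other eq2 l_def)
        qed
      next
        case (4 s3)
        have eq3: "nmem s3 ''n'' = nmem s ''n''" "nmem s3 ''k'' = nmem s ''k''" "nmem s3 ''q'' = nmem s ''q''"
          "nmem s3 ''adj'' = nmem s ''adj''" "nmem s3 ''c'' = nmem s ''c''" "rmem s3 ''l'' = rmem s ''l''"
          "rmem s3 ''D'' = rmem s1 ''D''"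
          using 4(2) eq2 by (simp_all add: frame_def)
        show ?case
        proof (rule runs_Seq[where B' = "n * 29 + 13",
            OF runs_For[where I = ?I and m = n and B = "n * 212 + 200" and B' = "n * (n * 212 + 217) + 13"]], goal_cases)
          case (7 m s4)
          have eq4: "nmem s4 ''n'' = nmem s ''n''" "nmem s4 ''k'' = nmem s ''k''"
            "nmem s4 ''adj'' = nmem s ''adj''" "rmem s4 ''l'' = rmem s ''l''" "rmem s4 ''D'' = rmem s1 ''D''"
            using 7(4) eq3 by (simp_all add: frame_def)
          have "0 < n" using 7(1) by simp
          have "runs P grow_step s4 (n * 212 + 200) (\<lambda>s'.
            ball_growing.ball_inv n ?a ?D (8 * real (nmem s4 ''k'' 0 0)) (rmem s4 ''l'' 0 0 / real n) (Suc m)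
              (nmem s' ''f'' 0) (nmem s' ''cid'' 0 0) (nmem s' ''u'' 0 0) (rmem s' ''cut'' 0 0) (rmem s' ''vol'' 0 0))"
            by (rule runs_grow_step)
              (use bg[OF \<open>0 < n\<close>] 7(1,2,3) 1(1) G(2) \<open>0 < n\<close> in \<open>simp_all add: eq4 k_def l_def holds_graph_def\<close>)
          then show ?case
            by (rule runs_mono) (simp_all add: eq4 k_def l_def)
        next
          case 8
          show ?case by (simp add: algebra_simps)
        next
          case (9 s4)
          have eq4: "nmem s4 ''n'' = nmem s ''n''" "nmem s4 ''q'' = nmem s ''q''" "nmem s4 ''c'' = nmem s ''c''"
            using 9(2) eq3 by (simp_all add: frame_def)
          have appr: "approximates n E (16 * real k + 2) l (nmem s4 ''f'' 0)"
          proof (cases "n = 0")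
            case True
            then show ?thesis
              using l by (auto simp: approximates_def clustering_of_labels_def LamPrime_def
                  intro!: mult_nonneg_nonneg sum_nonneg add_nonneg_nonneg)
          next
            case False
            then show ?thesis
              using approximates_ball_growing(2)[OF G(1) l _ opt \<alpha> gr] 9(1) by simp
          qed
          show ?case
          proof (rule runs_mono[OF runs_copy_labels[where n = n and q = q]], goal_cases)
            case (4 s5)
            then show ?case
              using appr approximates_cong[of n "nmem s5 ''c'' q" "nmem s4 ''f'' 0" E] by (simp add: eq4)
          qed (use n in \<open>simp_all add: eq4 q_def\<close>)
        next
          case 10
          show ?case by (simp add: algebra_simps)
        qed (use n 4(1) in \<open>auto simp: eq3 upd_apply upd_other\<close>)
      next
        case 5
        show ?case by (simp add: algebra_simps)
      qed (simp_all add: start_ball_def)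
    next
      case 3
      show ?case by (simp add: algebra_simps)
    qed (use n in \<open>simp add: eq1\<close>)
  next
    case 2
    show ?case by (simp add: algebra_simps)
  qed
qed

section \<open>The grid of parameters\<close>

text \<open>\<open>j\<close> counts the iterations. That \<open>N\<close> bounds them is not known
  in advance but has to follow from the invariant whenever the guard holds.\<close>

lemma runs_While:
  assumes init: "I 0 s"
    and step: "\<And>j s'. I j s' \<Longrightarrow> bval b s' \<Longrightarrow> j < N \<and> runs P c s' B (I (Suc j))"
  shows "runs P (While b c) s (N * (B + 1 + bcost b) + 1 + bcost b) (\<lambda>s'. \<exists>j. I j s' \<and> \<not> bval b s')"
proof -
  let ?Q = "\<lambda>s'. \<exists>j. I j s' \<and> \<not> bval b s'"
  have "runs P (While b c) s' ((N - j) * (B + 1 + bcost b) + 1 + bcost b) ?Q" if "I j s'" for j s'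
    using that
  proof (induction "N - j" arbitrary: j s' rule: less_induct)
    case less
    show ?case
    proof (cases "bval b s'")
      case False
      then show ?thesis
        using exec.WhileFalse[OF False, of P c] less(2) unfolding runs_def
        by (intro exI[of _ "1 + bcost b"] exI[of _ s']) auto
    next
      case True
      then have j: "j < N" and "runs P c s' B (I (Suc j))"
        using step[OF less(2)] by auto
      then obtain t s1 where s1: "exec P c s' t s1" "t \<le> B" "I (Suc j) s1"
        by (auto simp: runs_def)
      have "runs P (While b c) s1 ((N - Suc j) * (B + 1 + bcost b) + 1 + bcost b) ?Q"
        by (rule less(1)) (use j s1 in auto)
      then obtain u s2 where s2: "exec P (While b c) s1 u s2"
          "u \<le> (N - Suc j) * (B + 1 + bcost b) + 1 + bcost b" "?Q s2"
        unfolding runs_def by blast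
      have "N - j = Suc (N - Suc j)"
        using j by simp
      then have "1 + bcost b + t + u \<le> (N - j) * (B + 1 + bcost b) + 1 + bcost b"
        using s1(2) s2(2) by simp
      then show ?thesis
        using exec.WhileTrue[OF True s1(1) s2(1)] s2(3) unfolding runs_def by blast
    qed
  qed
  from this[OF init] show ?thesis by simp
qed

text \<open>The factor \<open>16384 = 2 ^ 14\<close> forces the size k to be at least 14, from where
  on \<open>(8 * k + 1)\<^sup>2 < 2 ^ k\<close> (at 14: 12769 < 16384). The factor
  \<open>(n + 1) ^ 4\<close> bounds \<open>n ^ 4\<close> by \<open>2 ^ k\<close>. Together they give
  \<open>grid_size_small\<close>, and the second one alone gives
  \<open>grid_size_growth\<close>.\<close>

definition grid_size :: "nat \<Rightarrow> nat" where
  "grid_size n = (LEAST k. 16384 * (n + 1) ^ 4 \<le> (2::nat) ^ k)"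

lemma grid_size_ge: "16384 * (n + 1) ^ 4 \<le> (2::nat) ^ grid_size n"
  unfolding grid_size_def by (rule LeastI[of _ "16384 * (n + 1) ^ 4"]) (rule less_imp_le, rule less_exp)

lemma grid_size_ge_power: "(n + 1) ^ 4 \<le> (2::nat) ^ grid_size n"
  by (rule order_trans[OF _ grid_size_ge]) simp

lemma grid_size_greater: "(2::nat) ^ j < 16384 * (n + 1) ^ 4 \<Longrightarrow> j < grid_size n"
proof (rule ccontr)
  assume "(2::nat) ^ j < 16384 * (n + 1) ^ 4" "\<not> j < grid_size n"
  then have "(2::nat) ^ grid_size n \<le> 2 ^ j"
    by (intro power_increasing) auto
  then show False
    using order_trans[OF grid_size_ge[of n]] \<open>2 ^ j < _\<close> by (simp add: not_less[symmetric])
qed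

lemma grid_size_le: "16384 * (n + 1) ^ 4 \<le> (2::nat) ^ j \<Longrightarrow> grid_size n \<le> j"
  unfolding grid_size_def by (rule Least_le)

lemma grid_size_ge_14: "14 \<le> grid_size n"
proof -
  have "(2::nat) ^ 14 \<le> 16384 * (n + 1) ^ 4"
    by simp
  also have "\<dots> \<le> 2 ^ grid_size n"
    by (rule grid_size_ge)
  finally show ?thesis
    by (rule power_le_imp_le_exp[rotated]) simp
qed

text \<open>Minimality bounds \<open>2 ^ (k - 1)\<close> by \<open>2 ^ 14 * n ^ 8\<close>. With
  \<open>ln 2\<close> at least \<open>1 / 2\<close> this gives
  \<open>k - 15 \<le> 16 * ln n\<close>, and \<open>ln n\<close> is at least 1 from
  \<open>n = 3\<close> on, so \<open>31 = 16 + 15\<close>.\<close>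

lemma grid_size_le_ln:
  assumes "3 \<le> n"
  shows "real (grid_size n) \<le> 31 * ln (real n)"
proof -
  let ?k = "grid_size n"
  have ln1: "1 \<le> ln (real n)"
    using assms exp_le by (subst ln_ge_iff) auto
  have ln2: "1 / 2 \<le> ln (2::real)"
  proof -
    have "1 \<le> ln (4::real)"
      using exp_le by (subst ln_ge_iff) auto
    also have "ln (4::real) = 2 * ln 2"
      using ln_realpow[of 2 2] by simp
    finally show ?thesis by simp
  qed
  have "(2::nat) ^ (?k - 1) < 16384 * (n + 1) ^ 4"
    using grid_size_le[of n "?k - 1"] grid_size_ge_14[of n] by (cases "16384 * (n + 1) ^ 4 \<le> (2::nat) ^ (?k - 1)") auto
  then have "(2::real) ^ (?k - 1) < 2 ^ 14 * (real n + 1) ^ 4"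
    using of_nat_less_iff[of "(2::nat) ^ (?k - 1)" "16384 * (n + 1) ^ 4", where 'a = real] by (simp add: add.commute)
  also have "\<dots> \<le> 2 ^ 14 * (real n ^ 2) ^ 4"
  proof -
    have "n + 1 \<le> n * n"
      using assms mult_le_mono1[OF assms, of n] by linarith
    then have "real n + 1 \<le> real n ^ 2"
      unfolding power2_eq_square of_nat_mult[symmetric] by linarith
    then show ?thesis
      by (intro mult_left_mono power_mono) auto
  qed
  also have "\<dots> = 2 ^ 14 * real n ^ 8"
    by (simp add: power_mult[symmetric])
  finally have "ln ((2::real) ^ (?k - 1)) < ln (2 ^ 14 * real n ^ 8)"
    using assms by (subst ln_less_cancel_iff) auto
  then have "real (?k - 1) * ln 2 < 14 * ln 2 + 8 * ln (real n)"
    using assms ln_realpow[of 2 14] by (simp add: ln_mult ln_realpow)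
  then have less: "(real ?k - 15) * ln 2 < 8 * ln (real n)"
    using grid_size_ge_14[of n] by (simp add: algebra_simps of_nat_diff)
  have "real ?k - 15 \<le> 16 * ln (real n)"
  proof (rule ccontr)
    assume *: "\<not> ?thesis"
    then have "(real ?k - 15) * (1 / 2) \<le> (real ?k - 15) * ln 2"
      using ln1 ln2 by (intro mult_left_mono) auto
    then have "(real ?k - 15) * (1 / 2) < 8 * ln (real n)"
      using less by (rule le_less_trans)
    then show False using * by simp
  qed
  then show ?thesis using ln1 by linarith
qed

lemma grid_size_bigo: "(\<lambda>n. c * real (grid_size n) + d) \<in> O(\<lambda>n. ln (real n))"
proof (rule bigoI[of _ "\<bar>c\<bar> * 31 + \<bar>d\<bar>"], rule eventually_sequentiallyI[of 3])
  fix n :: nat assume n: "3 \<le> n"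
  have ln1: "1 \<le> ln (real n)"
    using n exp_le by (subst ln_ge_iff) auto
  have "\<bar>c * real (grid_size n) + d\<bar> \<le> \<bar>c\<bar> * real (grid_size n) + \<bar>d\<bar> * 1"
    using abs_triangle_ineq[of "c * real (grid_size n)" d] by (simp add: abs_mult)
  also have "\<dots> \<le> \<bar>c\<bar> * (31 * ln (real n)) + \<bar>d\<bar> * ln (real n)"
    using grid_size_le_ln[OF n] ln1 by (intro add_mono mult_left_mono) auto
  finally show "norm (c * real (grid_size n) + d) \<le> (\<bar>c\<bar> * 31 + \<bar>d\<bar>) * norm (ln (real n))"
    using ln1 by (simp add: algebra_simps)
qed

text \<open>Since \<open>l * 2 ^ k\<close> is at least 1, the term \<open>n ^ 2\<close> is at most
  \<open>l / n\<close> times \<open>n ^ 3 * 2 ^ k\<close>. The bound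
  \<open>1 + n ^ 3 \<le> 2 ^ k\<close> then leaves the factor \<open>4 ^ k\<close>, which is below
  \<open>exp (2 * k)\<close>.\<close>

lemma grid_size_growth:
  assumes n: "0 < n" and l: "1 / 2 ^ grid_size n \<le> l"
  shows "l / n + real n ^ 2 \<le> l / n * exp (2 * real (grid_size n))"
proof -
  let ?k = "grid_size n"
  have "1 + n ^ 3 \<le> (n + 1) ^ 3"
    by (simp add: power3_eq_cube algebra_simps)
  also have "\<dots> \<le> (n + 1) ^ 4"
    by (rule power_increasing) auto
  also have "\<dots> \<le> 2 ^ ?k"
    by (rule grid_size_ge_power)
  finally have nk: "1 + real n ^ 3 \<le> 2 ^ ?k"
    using of_nat_le_iff[of "1 + n ^ 3" "2 ^ ?k", where 'a = real] by simp
  have l0: "0 < l"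
    using l by (rule less_le_trans[rotated]) simp
  have "1 \<le> l * 2 ^ ?k"
    using l by (simp add: divide_le_eq)
  then have "real n ^ 2 * 1 \<le> real n ^ 2 * (l * 2 ^ ?k)"
    by (rule mult_left_mono) simp
  moreover have "l / n * (1 + real n ^ 3 * 2 ^ ?k) = l / n + real n ^ 2 * (l * 2 ^ ?k)"
    using n by (simp add: distrib_left power2_eq_square power3_eq_cube)
  ultimately have "l / n + real n ^ 2 \<le> l / n * (1 + real n ^ 3 * 2 ^ ?k)"
    by linarith
  also have "\<dots> \<le> l / n * ((1 + real n ^ 3) * 2 ^ ?k)"
    using l0 by (intro mult_left_mono) (auto simp: algebra_simps)
  also have "\<dots> \<le> l / n * (2 ^ ?k * 2 ^ ?k)"
    using l0 nk by (intro mult_left_mono mult_right_mono) auto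
  also have "\<dots> \<le> l / n * exp (2 * real ?k)"
  proof -
    have "(2::real) ^ (2 * ?k) \<le> exp 1 ^ (2 * ?k)"
      using exp_ge_add_one_self[of 1] by (intro power_mono) auto
    also have "\<dots> = exp (2 * real ?k)"
      by (simp add: exp_of_nat_mult[symmetric])
    also have "(2::real) ^ (2 * ?k) = 2 ^ ?k * 2 ^ ?k"
      by (simp only: mult_2 power_add)
    finally show ?thesis
      using l0 by (intro mult_left_mono) auto
  qed
  finally show ?thesis .
qed

lemma square_less_exp: "14 \<le> k \<Longrightarrow> (8 * k + 1)\<^sup>2 < (2::nat) ^ k"
proof (induction rule: dec_induct)
  case (step k)
  have "14 * k \<le> k * k"
    using step(1) by (rule mult_le_mono1)
  then have "79 + k * 112 \<le> k * k * 64"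
    using step(1) by linarith
  then have "(8 * Suc k + 1)\<^sup>2 \<le> 2 * (8 * k + 1)\<^sup>2"
    using step(1) by (simp add: power2_eq_square algebra_simps)
  then show ?case using step(3) by simp
qed simp

lemma grid_size_small: "(16 * real (grid_size n) + 2) * real (n choose 2) < 2 ^ grid_size n"
proof -
  let ?k = "grid_size n"
  have n4: "n ^ 4 \<le> 2 ^ ?k"
  proof -
    have "n ^ 4 \<le> (n + 1) ^ 4"
      by (rule power_mono) auto
    also have "\<dots> \<le> 2 ^ ?k"
      by (rule grid_size_ge_power)
    finally show ?thesis .
  qed
  \<comment> \<open>After squaring, each of the two factors is bounded by one
    \<open>2 ^ ?k\<close>.\<close>
  have "((8 * ?k + 1) * n\<^sup>2)\<^sup>2 = (8 * ?k + 1)\<^sup>2 * n ^ 4"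
    unfolding power_mult_distrib by (simp flip: power_mult)
  also have "\<dots> \<le> (8 * ?k + 1)\<^sup>2 * 2 ^ ?k"
    using n4 by simp
  also have "\<dots> < 2 ^ ?k * 2 ^ ?k"
    using square_less_exp[OF grid_size_ge_14[of n]] by simp
  also have "\<dots> = (2 ^ ?k)\<^sup>2"
    by (simp add: power2_eq_square)
  finally have "(8 * ?k + 1) * n\<^sup>2 < 2 ^ ?k"
    by (rule power_less_imp_less_base) simp
  moreover have "(16 * ?k + 2) * (n choose 2) \<le> (8 * ?k + 1) * n\<^sup>2"
  proof -
    have "2 * (n choose 2) \<le> n * (n - 1)"
      by (simp add: choose_two)
    also have "\<dots> \<le> n\<^sup>2"
      by (simp add: power2_eq_square)
    finally have "(8 * ?k + 1) * (2 * (n choose 2)) \<le> (8 * ?k + 1) * n\<^sup>2"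
      by (rule mult_le_mono2)
    then show ?thesis by (simp add: algebra_simps)
  qed
  ultimately have "(16 * ?k + 2) * (n choose 2) < 2 ^ ?k"
    by linarith
  then have "real ((16 * ?k + 2) * (n choose 2)) < real (2 ^ ?k)"
    by (simp only: of_nat_less_iff)
  then show ?thesis by (simp add: algebra_simps)
qed

section \<open>The complete program\<close>

definition initialise :: com where
  "initialise = Seq (nset ''k'' (NConst 0)) (Seq (rset ''p'' (ROfNat (NConst 1)))
     (rset ''M'' (let N = ROfNat (NAdd (nvar ''n'') (NConst 1))
        in RMul (ROfNat (NConst 16384)) (RMul (RMul N N) (RMul N N)))))"

text \<open>The machine has neither logarithms nor multiplication of naturals. Hence the threshold
  \<open>M\<close> and the power \<open>p\<close> are kept as exact reals, and \<open>k\<close> is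
  found by repeated doubling.\<close>

definition find_grid_size :: com where
  "find_grid_size = While (RLess (rvar ''p'') (rvar ''M''))
     (Seq (rset ''p'' (RAdd (rvar ''p'') (rvar ''p''))) (nset ''k'' (NAdd (nvar ''k'') (NConst 1))))"

text \<open>Halving comes before solving: \<open>l\<close> starts at 1, for which the solver
  promises nothing, and the first LP is solved at \<open>1 / 2\<close>.\<close>

definition grid_step :: com where
  "grid_step = Seq (rset ''l'' (RDiv (rvar ''l'') (ROfNat (NConst 2)))) (Seq (Solve (rvar ''l'')) rounding)"

definition cluster_all :: com where
  "cluster_all = Seq initialise (Seq find_grid_size (Seq (rset ''l'' (ROfNat (NConst 1)))
     (Seq (For ''q'' ''k'' grid_step) (nset ''count'' (nvar ''k'')))))"

lemma writes_grid [simp]: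
  "nwrites initialise = {''k''}" "rwrites initialise = {''p'', ''M''}"
  "nwrites find_grid_size = {''k''}" "rwrites find_grid_size = {''p''}"
  "nwrites grid_step = {''i'', ''j'', ''w'', ''u'', ''cid'', ''m'', ''f'', ''c''}"
  "rwrites grid_step = {''l'', ''x'', ''D'', ''cut'', ''vol''}"
  by (auto simp: initialise_def find_grid_size_def grid_step_def)

lemma runs_find_grid_size:
  assumes "rmem s ''p'' 0 0 = 1" "nmem s ''k'' 0 0 = 0" "rmem s ''M'' 0 0 = 16384 * (real n + 1) ^ 4"
  shows "runs P find_grid_size s (grid_size n * 60 + 20) (\<lambda>s'. nmem s' ''k'' 0 0 = grid_size n)"
proof -
  let ?I = "\<lambda>j s'. rmem s' ''p'' 0 0 = 2 ^ j \<and> nmem s' ''k'' 0 0 = j \<and> j \<le> grid_size n \<and>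
    rmem s' ''M'' 0 0 = real (16384 * (n + 1) ^ 4)"
  show ?thesis
    unfolding find_grid_size_def
  proof (rule runs_mono[OF runs_While[where I = ?I and N = "grid_size n" and B = 24]], goal_cases)
    case 1
    show ?case using assms by (simp add: add.commute)
  next
    case (2 j s')
    then have "real (2 ^ j) < real (16384 * (n + 1) ^ 4)"
      by simp
    then have j: "j < grid_size n"
      unfolding of_nat_less_iff by (rule grid_size_greater)
    moreover have "runs P (Seq (rset ''p'' (RAdd (rvar ''p'') (rvar ''p'')))
        (nset ''k'' (NAdd (nvar ''k'') (NConst 1)))) s' 24 (?I (Suc j))"
      by (rule runs_loop_free) (use 2 j in \<open>auto simp: upd_apply\<close>)
    ultimately show ?case ..
  next
    case 3
    show ?case by simp
  next
    case (4 s')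
    then obtain j where j: "?I j s'" "\<not> bval (RLess (rvar ''p'') (rvar ''M'')) s'"
      by blast
    then have "real (16384 * (n + 1) ^ 4) \<le> real (2 ^ j)"
      by simp
    then have "grid_size n \<le> j"
      unfolding of_nat_le_iff by (rule grid_size_le)
    then show ?case using j by simp
  qed
qed

lemma runs_cluster_all:
  assumes P: "lp_solver P T" and G: "simple_graph {..<n} E" "holds_graph s n E"
  shows "runs P cluster_all s (3000 * grid_size n * T n E) (\<lambda>s'. nmem s' ''count'' 0 0 = grid_size n \<and>
    (\<forall>q<grid_size n. approximates n E (16 * real (grid_size n) + 2) (1 / 2 ^ Suc q) (nmem s' ''c'' q)))"
proof -
  let ?k = "grid_size n" and ?T = "T n E"
  let ?R = "\<lambda>q. approximates n E (16 * real ?k + 2) (1 / 2 ^ Suc q)"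
  let ?B = "?T + n * (n * 282 + 299) + 130"
  have n: "nmem s ''n'' 0 0 = n"
    using G by (simp add: holds_graph_def)
  have k: "14 \<le> ?k"
    by (rule grid_size_ge_14)
  have T: "n * n \<le> 4 * ?T" "0 < ?T"
    by (rule lp_solver_time_ge[OF P G(1)])+
  let ?I = "\<lambda>q s'. rmem s' ''l'' 0 0 = 1 / 2 ^ q \<and> (\<forall>q'<q. ?R q' (nmem s' ''c'' q'))"
  have step: "runs P grid_step s' ?B (?I (Suc q))"
    if s': "?I q s'" "nmem s' ''q'' 0 0 = q" "holds_graph s' n E" "nmem s' ''k'' 0 0 = ?k" "q < ?k" for q s'
    unfolding grid_step_def
  proof (rule runs_Seq[where B' = "?T + n * (n * 282 + 299) + 109",
        OF runs_loop_free[where B = 20 and Q = "\<lambda>s1. s1 = s'\<lparr>rmem := upd (rmem s') ''l'' 0 0 (1 / 2 ^ Suc q)\<rparr>"]],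
      goal_cases)
    case (4 s1)
    have s1: "holds_graph s1 n E" "nmem s1 = nmem s'" "rval (rvar ''l'') s1 = 1 / 2 ^ Suc q"
      using 4(1) s' by (simp_all add: upd_apply holds_graph_def)
    have l: "0 < rval (rvar ''l'') s1" "rval (rvar ''l'') s1 < 1"
      unfolding s1(3) using one_less_power[of "2::real" "Suc q"] by simp_all
    show ?case
    proof (rule runs_Seq[where B' = "n * (n * 282 + 299) + 100", OF runs_Solve[OF P G(1) s1(1) l]], goal_cases)
      case (1 s2)
      have s2: "nmem s2 = nmem s'" "rmem s2 ''l'' = rmem s1 ''l''"
        using 1(2) s1(2) by (simp_all add: frame_def fun_eq_iff)
      have l2: "rmem s2 ''l'' 0 0 = 1 / 2 ^ Suc q"
        using s1(3) s2(2) by simp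
      have opt: "lp_optimal {..<n} E (rmem s2 ''l'' 0 0) (lp_output s2)"
        using 1(1) unfolding s1(3) l2 .
      have le: "1 / 2 ^ ?k \<le> rmem s2 ''l'' 0 0"
        unfolding l2 using that(5) by (intro divide_left_mono power_increasing) auto
      show ?case
      proof (rule runs_mono[OF runs_rounding[OF G(1) _ _ _ _ opt]], goal_cases)
        case 5
        show ?case using grid_size_growth[OF 5 le] s'(4) by (simp add: s2)
      next
        case (7 s3)
        have "rmem s3 ''l'' 0 0 = 1 / 2 ^ Suc q"
          using 7(2) l2 by (simp add: frame_def)
        moreover have "?R q' (nmem s3 ''c'' q')" if "q' < Suc q" for q'
          using 7(1) s'(1,2,4) that l2 by (cases "q' = q") (simp_all add: s2)
        ultimately show ?case by blast
      qed (use s' s2 l l2 s1(3) k in \<open>simp_all add: holds_graph_def\<close>)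
    qed simp
  qed (use s' in \<open>simp_all add: mult.commute\<close>)
  show ?thesis
    unfolding cluster_all_def
  proof (rule runs_Seq[where B' = "?k * (?B + 17) + ?k * 60 + 70", OF runs_loop_free[where B = 60 and
        Q = "\<lambda>s1. rmem s1 ''p'' 0 0 = 1 \<and> nmem s1 ''k'' 0 0 = 0 \<and> rmem s1 ''M'' 0 0 = 16384 * (real n + 1) ^ 4"]],
      goal_cases)
    case 3
    show ?case
      using n by (simp add: initialise_def Let_def upd_apply upd_other power4_eq_xxxx add.commute mult.assoc)
  next
    case (4 s1)
    show ?case
    proof (rule runs_Seq[where B' = "?k * (?B + 17) + 49", OF runs_find_grid_size[where n = n]], goal_cases)
      case (4 s2)
      show ?case
      proof (rule runs_Seq[where B' = "?k * (?B + 17) + 38",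
            OF runs_loop_free[where B = 10 and Q = "\<lambda>s3. s3 = s2\<lparr>rmem := upd (rmem s2) ''l'' 0 0 1\<rparr>"]], goal_cases)
        case (4 s3)
        have s3: "nmem s3 ''n'' = nmem s ''n''" "nmem s3 ''adj'' = nmem s ''adj''" "nmem s3 ''k'' 0 0 = ?k"
          using 4(2) \<open>frame _ _ s s1\<close> \<open>frame _ _ s1 s2\<close> \<open>nmem s2 ''k'' 0 0 = ?k\<close> by (simp_all add: frame_def)
        show ?case
        proof (rule runs_Seq[where B' = 20, OF runs_For[where I = ?I and m = ?k and B = ?B and B' = "?k * (?B + 17) + 13"]],
            goal_cases)
          case (7 q s4)
          have "nmem s4 ''n'' = nmem s ''n''" "nmem s4 ''adj'' = nmem s ''adj''" "nmem s4 ''k'' 0 0 = ?k"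
            using 7(4) s3 by (simp_all add: frame_def)
          then show ?case
            using 7 G(2) by (intro step) (simp_all add: holds_graph_def)
        next
          case (9 s4)
          have "nmem s4 ''k'' 0 0 = ?k"
            using 9(2) s3 by (simp add: frame_def)
          then show ?case
            using 9(1) by (intro runs_loop_free) (simp_all add: upd_apply upd_other)
        qed (use 4(1) s3 in \<open>auto simp: upd_apply upd_other\<close>)
      qed simp_all
    qed (use 4 in simp_all)
  next
    case 5
    \<comment> \<open>With \<open>n * n\<close> at most \<open>4 * ?T\<close>, the rounding costs at
      most \<open>2324 * ?T\<close>. The LP itself adds \<open>?T\<close> and the constants
      \<open>338 * ?T\<close>, as \<open>?T\<close> is positive; 3000 leaves some slack.\<close>
    have "n * (n * 282 + 299) \<le> 581 * (n * n)"
      by (cases n) (simp_all add: algebra_simps)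
    then have "?B + 17 + 60 + 131 \<le> 3000 * ?T"
      using T by linarith
    then have "?k * (?B + 17 + 60 + 131) \<le> ?k * (3000 * ?T)"
      by (rule mult_le_mono2)
    then show ?case
      using k by (simp add: algebra_simps)
  qed (simp_all add: initialise_def Let_def)
qed

lemma cluster_all_correct:
  assumes P: "lp_solver P T" and G: "simple_graph {..<n} E" "holds_graph s n E"
  shows "\<exists>t s'. exec P cluster_all s t s' \<and> real t \<le> (3000 * real (grid_size n)) * real (T n E) \<and>
      (\<forall>C \<in> output_clusterings s' n. partition_on {..<n} C) \<and>
      real (card (output_clusterings s' n)) \<le> real (grid_size n) \<and>
      (\<forall>l. 0 < l \<and> l < 1 \<longrightarrow> (\<exists>C \<in> output_clusterings s' n. LamPrime E C l \<le> (32 * real (grid_size n) + 4) * LamPrime_min {..<n} E l))"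
proof -
  let ?k = "grid_size n"
  obtain t s' where s': "exec P cluster_all s t s'" "t \<le> 3000 * ?k * T n E"
      "nmem s' ''count'' 0 0 = ?k"
      "\<And>q. q < ?k \<Longrightarrow> approximates n E (16 * real ?k + 2) (1 / 2 ^ Suc q) (nmem s' ''c'' q)"
    using runs_cluster_all[OF P G] unfolding runs_def by blast
  have out: "output_clusterings s' n = (\<lambda>q. clustering_of_labels n (nmem s' ''c'' q)) ` {..<?k}"
    by (simp add: output_clusterings_def s'(3))
  have "real t \<le> real (3000 * ?k * T n E)"
    using s'(2) by (simp only: of_nat_le_iff)
  then have time: "real t \<le> (3000 * real (grid_size n)) * real (T n E)"
    by simp
  have parts: "\<forall>C \<in> output_clusterings s' n. partition_on {..<n} C"
    unfolding out using partition_on_clustering_of_labels by blast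
  have size: "real (card (output_clusterings s' n)) \<le> real (grid_size n)"
    unfolding out using card_image_le[of "{..<?k}"] by simp
  have "\<exists>C \<in> output_clusterings s' n. LamPrime E C l \<le> (32 * real (grid_size n) + 4) * LamPrime_min {..<n} E l"
    if l: "0 < l" "l < 1" for l
  proof -
    have "\<exists>q<?k. approximates n E (2 * (16 * real ?k + 2)) l (nmem s' ''c'' q)"
      by (rule approximates_grid[OF G(1) l _ _ grid_size_small s'(4)]) (use grid_size_ge_14[of n] in auto)
    then obtain q where q: "q < ?k" "approximates n E (2 * (16 * real ?k + 2)) l (nmem s' ''c'' q)"
      by blast
    then have "LamPrime E (clustering_of_labels n (nmem s' ''c'' q)) l \<le> (32 * real (grid_size n) + 4) * LamPrime_min {..<n} E l"
      using approximates_LamPrime_min[OF q(2)] by simp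
    then show ?thesis
      unfolding out using q(1) by blast
  qed
  then show ?thesis
    using s'(1) time parts size by blast
qed

theorem theorem4:
  "\<exists>(A :: com) (size_bd :: nat \<Rightarrow> real) (ratio :: nat \<Rightarrow> real) (overhead :: nat \<Rightarrow> real).
     size_bd \<in> O(\<lambda>n. ln (real n)) \<and> ratio \<in> O(\<lambda>n. ln (real n)) \<and> overhead \<in> O(\<lambda>n. ln (real n)) \<and>
     (\<forall>P T. lp_solver P T \<longrightarrow>
       (\<forall>n E s. simple_graph {..<n} E \<and> holds_graph s n E \<longrightarrow>
         (\<exists>t s'. exec P A s t s' \<and>
            real t \<le> overhead n * real (T n E) \<and>
            (\<forall>C \<in> output_clusterings s' n. partition_on {..<n} C) \<and>
            real (card (output_clusterings s' n)) \<le> size_bd n \<and>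
            (\<forall>l. 0 < l \<and> l < 1 \<longrightarrow>
               (\<exists>C \<in> output_clusterings s' n.
                  LamPrime E C l \<le> ratio n * LamPrime_min {..<n} E l)))))"
proof -
  let ?O = "O(\<lambda>n. ln (real n))"
  have "(\<lambda>n. real (grid_size n)) \<in> ?O" "(\<lambda>n. 32 * real (grid_size n) + 4) \<in> ?O"
    "(\<lambda>n. 3000 * real (grid_size n)) \<in> ?O"
    using grid_size_bigo[of 1 0] grid_size_bigo[of 32 4] grid_size_bigo[of 3000 0] by simp_all
  with cluster_all_correct show ?thesis
    by (intro exI[of _ cluster_all] exI[of _ "\<lambda>n. real (grid_size n)"]
        exI[of _ "\<lambda>n. 32 * real (grid_size n) + 4"] exI[of _ "\<lambda>n. 3000 * real (grid_size n)"] conjI allI impI)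
      simp_all
qed

end
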